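(* Let $F:[0,1]\times[0,\infty)\to\mathbb{R}$ be such that $F(0,t)=F(1,t)=0$ and $\frac{\partial^2F}{\partial x^2}(0,t)=\frac{\partial^2F}{\partial x^2}(1,t)=0$ for all $t\ge0$, and such that $F$, $\frac{\partial F}{\partial x}$, $\frac{\partial^2F}{\partial x^2}$ are continuous and bounded on $[0,1]\times[0,\infty)$. Then the unique bounded solution $u_2:[0,1]\times[0,\infty)\to\mathbb{R}$ of the problem $$\frac{\partial u}{\partial t}(x,t)-\frac{\partial^2 u}{\partial x^2}(x,t)=F(x,t),\quad t>0,\ x\in(0,1),$$ $$u(0,t)=u(1,t)=0,\quad t>0,\qquad u(x,0)=0,\quad x\in[0,1],$$ is given, for all $x\in[0,1]$ and $t\ge0$, by $$u_2(x,t)=\frac{1}{2\pi}\int_0^t\left(\mathrm{P.V.}\int_{-\infty}^{\infty}\int_0^1 e^{ir(t-s)}\,g(\sqrt{ir},x,y)\,F(y,s)\,dy\,dr\right)ds,$$ where $\mathrm{P.V.}\int_{-\infty}^{\infty}(\cdot)\,dr=\lim_{M\to\infty}\int_{-M}^{M}(\cdot)\,dr$, the limit being taken for each $s\in[0,t)$.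
   Context: A solution is a function $u:[0,1]\times[0,\infty)\to\mathbb{R}$ with $u,\,u_t,\,u_{xx}\in C([0,1]\times[0,\infty))$ satisfying the equation, the boundary conditions and the initial condition. Under the stated hypotheses it is well known that there is a unique bounded solution. The function $g$ is defined for $x,y\in[0,1]$ and $m\in\mathbb{C}$ with $m\neq0$, $\sinh m\ne 0$, by $$g(m,x,y)=\frac{-1}{m\sinh m}\begin{cases}\sinh(m(x-1))\,\sinh(my), & 0\le y\le x\le 1,\\ \sinh(mx)\,\sinh(m(y-1)), & 0\le x<y\le 1,\end{cases}$$ and for $m=0$ by $$g(0,x,y)=\begin{cases}(1-x)\,y, & 0\le y\le x\le 1,\\ x\,(1-y), & 0\le x<y\le 1.\end{cases}$$ For $r\in\mathbb{R}$, $\sqrt{ir}$ denotes a complex square root of $ir$, i.e. a complex number $m$ with $m^2=ir$. Since $g(-m,x,y)=g(m,x,y)$, the value $g(\sqrt{ir},x,y)$ does not depend on which of the two square roots is chosen. *)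

theory Defs
  imports "HOL-Complex_Analysis.Complex_Analysis"
begin

abbreviation half_strip :: "(real \<times> real) set" where
  "half_strip \<equiv> {0..1} \<times> {0..}"

text \<open>
  Functions on the half strip are total functions \<open>real \<Rightarrow> real \<Rightarrow> real\<close> (position first, time
  second) of which only the values on the strip matter: the partial derivatives are taken within
  \<open>[0,1]\<close> and within \<open>[0,\<infinity>)\<close>, hence are one-sided at \<open>x = 0\<close>, \<open>x = 1\<close> and \<open>t = 0\<close>.
\<close>

definition has_dx :: "(real \<Rightarrow> real \<Rightarrow> real) \<Rightarrow> (real \<Rightarrow> real \<Rightarrow> real) \<Rightarrow> bool" where
  "has_dx u u' \<longleftrightarrow>
     (\<forall>x\<in>{0..1}. \<forall>t\<ge>0. ((\<lambda>\<xi>. u \<xi> t) has_real_derivative u' x t) (at x within {0..1}))"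

definition has_dt :: "(real \<Rightarrow> real \<Rightarrow> real) \<Rightarrow> (real \<Rightarrow> real \<Rightarrow> real) \<Rightarrow> bool" where
  "has_dt u u' \<longleftrightarrow>
     (\<forall>x\<in>{0..1}. \<forall>t\<ge>0. ((\<lambda>\<tau>. u x \<tau>) has_real_derivative u' x t) (at t within {0..}))"

definition cont_strip :: "(real \<Rightarrow> real \<Rightarrow> real) \<Rightarrow> bool" where
  "cont_strip u \<longleftrightarrow> continuous_on half_strip (\<lambda>(x, t). u x t)"

definition bounded_strip :: "(real \<Rightarrow> real \<Rightarrow> real) \<Rightarrow> bool" where
  "bounded_strip u \<longleftrightarrow> bounded ((\<lambda>(x, t). u x t) ` half_strip)"

definition heat_solution :: "(real \<Rightarrow> real \<Rightarrow> real) \<Rightarrow> (real \<Rightarrow> real \<Rightarrow> real) \<Rightarrow> bool" where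
  "heat_solution F u \<longleftrightarrow>
     (\<exists>ut ux uxx.
        has_dt u ut \<and> has_dx u ux \<and> has_dx ux uxx \<and>
        cont_strip u \<and> cont_strip ut \<and> cont_strip uxx \<and>
        (\<forall>x\<in>{0<..<1}. \<forall>t>0. ut x t - uxx x t = F x t) \<and>
        (\<forall>t>0. u 0 t = 0 \<and> u 1 t = 0) \<and>
        (\<forall>x\<in>{0..1}. u x 0 = 0))"

definition green :: "complex \<Rightarrow> real \<Rightarrow> real \<Rightarrow> complex" where
  "green m x y =
     (if m = 0 then (if y \<le> x then of_real ((1 - x) * y) else of_real (x * (1 - y)))
      else - 1 / (m * sinh m) *
        (if y \<le> x then sinh (m * of_real (x - 1)) * sinh (m * of_real y)
         else sinh (m * of_real x) * sinh (m * of_real (y - 1))))"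

lemma green_minus: "green (- m) x y = green m x y"
  by (simp add: green_def)

text \<open>Any square root of \<open>\<i> r\<close> may be used in place of the principal one.\<close>

lemma green_csqrt:
  assumes "m\<^sup>2 = \<i> * of_real r"
  shows "green (csqrt (\<i> * of_real r)) x y = green m x y"
proof -
  have "(csqrt (\<i> * of_real r))\<^sup>2 = m\<^sup>2"
    using assms by simp
  then have "csqrt (\<i> * of_real r) = m \<or> csqrt (\<i> * of_real r) = - m"
    by (simp only: power2_eq_iff)
  then show ?thesis
    by (auto simp: green_minus)
qed

definition heat_integrand ::
  "(real \<Rightarrow> real \<Rightarrow> real) \<Rightarrow> real \<Rightarrow> real \<Rightarrow> real \<Rightarrow> real \<Rightarrow> real \<Rightarrow> complex" where
  "heat_integrand F x t s r y =
     exp (\<i> * of_real r * of_real (t - s)) * green (csqrt (\<i> * of_real r)) x y * of_real (F y s)"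

definition has_pv_integral :: "(real \<Rightarrow> complex) \<Rightarrow> complex \<Rightarrow> bool" where
  "has_pv_integral f L \<longleftrightarrow>
     (\<forall>M\<ge>0. set_integrable lborel {-M..M} f) \<and>
     ((\<lambda>M. LBINT r:{-M..M}. f r) \<longlongrightarrow> L) at_top"

definition pv_integral :: "(real \<Rightarrow> complex) \<Rightarrow> complex" where
  "pv_integral f = Lim at_top (\<lambda>M. LBINT r:{-M..M}. f r)"

end

theory Submission
  imports Defs "HOL-Real_Asymp.Real_Asymp"
begin

text \<open>
  Everything is diagonal in the functions \<open>sin (n \<pi> x)\<close>, \<open>n \<ge> 1\<close>, the eigenfunctions of the second
  derivative with zero boundary values.

  Integrating by parts twice, the sine coefficients \<open>f\<^sub>n(s)\<close> of \<open>F(\<cdot>, s)\<close> are \<open>O(n\<^sup>-\<^sup>2)\<close> uniformly in \<open>s\<close>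
  (\<open>sine_coeff_bound\<close>), and \<open>F(\<cdot>, s)\<close> is the sum of its sine series (\<open>sine_series\<close>). The heat equation
  decouples into \<open>u\<^sub>n' = f\<^sub>n - n\<^sup>2\<pi>\<^sup>2 u\<^sub>n\<close>, \<open>u\<^sub>n(0) = 0\<close>, whose solution is Duhamel's integral of
  \<open>f\<^sub>n(s) exp (- n\<^sup>2\<pi>\<^sup>2 (t - s))\<close> over \<open>[0, t]\<close>. The dissipation gains a further factor \<open>n\<^sup>-\<^sup>2\<close>,
  so \<open>u\<^sub>n = O(n\<^sup>-\<^sup>4)\<close>, and the series of \<open>u\<close>, \<open>u\<^sub>t\<close> and \<open>u\<^sub>x\<^sub>x\<close> all converge uniformly on the closed half
  strip; this is existence (\<open>heat_solution_sol\<close>). Conversely the sine coefficients of the difference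
  of two solutions satisfy the homogeneous equation with zero initial value and hence vanish, and a
  continuous function with vanishing sine coefficients is zero (\<open>sine_complete\<close>); this is uniqueness
  (\<open>heat_solution_zero\<close>).

  For the integral formula, \<open>green m\<close> is the kernel of the inverse of \<open>m\<^sup>2 - d\<^sup>2/dx\<^sup>2\<close> with zero boundary
  values, so it multiplies the \<open>n\<close>-th mode by \<open>1 / (m\<^sup>2 + n\<^sup>2\<pi>\<^sup>2)\<close> (\<open>green_sine\<close>). With \<open>m\<^sup>2 = \<i> r\<close>, the
  principal value integral over \<open>r\<close> is a Laplace inversion along the imaginary axis:
  the truncated integrals of \<open>exp (\<i> r \<tau>) / (\<i> r + \<lambda>)\<close> tend to \<open>2 \<pi> exp (- \<lambda> \<tau>)\<close>
  (\<open>bromwich_limit\<close>). They are moreover bounded uniformly in \<open>\<lambda> \<ge> 1\<close> (\<open>bromwich_bound\<close>), which is what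
  allows the limit to be taken under the sum over \<open>n\<close> (\<open>green_transform_pv\<close>). Integrating over \<open>s\<close>
  turns the result back into Duhamel's integrals, that is, into \<open>2 \<pi> u(x, t)\<close>.
\<close>

section \<open>Sine series on the unit interval\<close>

definition freq :: "nat \<Rightarrow> real" where
  "freq n = real (Suc n) * pi"

text \<open>The factor 2 normalises: \<open>sin\<^sup>2\<close> of a mode integrates to 1/2 over the unit interval.\<close>

definition sine_coeff :: "(real \<Rightarrow> real) \<Rightarrow> nat \<Rightarrow> real" where
  "sine_coeff h n = 2 * integral {0..1} (\<lambda>y. h y * sin (freq n * y))"

lemma freq_pos: "freq n > 0"
  by (simp add: freq_def)

lemma freq_ge_1: "freq n \<ge> 1"
proof -
  have "1 * 1 \<le> real (Suc n) * pi"
    using pi_gt3 by (intro mult_mono) auto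
  then show ?thesis by (simp add: freq_def)
qed

lemma freq_eq_iff: "freq n = freq k \<longleftrightarrow> n = k"
  by (simp add: freq_def)

lemma sin_freq [simp]: "sin (freq n) = 0"
  unfolding freq_def by (rule sin_npi)

lemma summable_inverse_freq_sq: "summable (\<lambda>n. 1 / (freq n)\<^sup>2)"
proof -
  have "summable (\<lambda>n. 1 / pi\<^sup>2 * inverse (real (Suc n) ^ 2))"
    by (intro summable_mult, subst summable_Suc_iff, rule inverse_power_summable) simp
  then show ?thesis
    by (simp add: freq_def power_mult_distrib divide_simps mult.commute)
qed

lemma series_of_continuous:
  fixes f :: "nat \<Rightarrow> 'a::topological_space \<Rightarrow> 'b::banach"
  assumes "\<And>n. continuous_on S (f n)"
    and "\<And>n x. x \<in> S \<Longrightarrow> norm (f n x) \<le> B n" and "summable B"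
  shows "uniform_limit S (\<lambda>n x. \<Sum>i<n. f i x) (\<lambda>x. \<Sum>i. f i x) sequentially"
    and "continuous_on S (\<lambda>x. \<Sum>i. f i x)"
proof -
  show u: "uniform_limit S (\<lambda>n x. \<Sum>i<n. f i x) (\<lambda>x. \<Sum>i. f i x) sequentially"
    using assms(2,3) by (intro Weierstrass_m_test) auto
  show "continuous_on S (\<lambda>x. \<Sum>i. f i x)"
    by (rule uniform_limit_theorem[OF _ u])
      (auto intro!: always_eventually continuous_on_sum assms(1))
qed

lemma integral_series_of_continuous:
  fixes f :: "nat \<Rightarrow> real \<Rightarrow> 'b::banach"
  assumes c: "\<And>n. continuous_on {a..b} (f n)"
    and b: "\<And>n x. x \<in> {a..b} \<Longrightarrow> norm (f n x) \<le> B n" and s: "summable B"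
  shows "(\<lambda>n. integral {a..b} (f n)) sums integral {a..b} (\<lambda>x. \<Sum>i. f i x)"
proof -
  have c': "continuous_on {a..b} (\<lambda>x. \<Sum>i<n. f i x)" for n
    by (intro continuous_on_sum c)
  obtain I J where I: "\<And>n. ((\<lambda>x. \<Sum>i<n. f i x) has_integral I n) {a..b}"
    and J: "((\<lambda>x. \<Sum>i. f i x) has_integral J) {a..b}" and lim: "I \<longlonglongrightarrow> J"
    using uniform_limit_integral[OF series_of_continuous(1)[OF c b s] c'] by auto
  have "I n = (\<Sum>i<n. integral {a..b} (f i))" for n
    using integral_unique[OF I[of n]]
    by (subst (asm) integral_sum) (auto intro!: integrable_continuous_interval c)
  then show ?thesis
    using Lim_transform_eventually[OF lim] integral_unique[OF J] unfolding sums_def by simp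
qed

text \<open>
  Two integrations by parts in one step: \<open>h' sin (a y) - a h cos (a y)\<close> is a primitive of
  \<open>(h'' + a\<^sup>2 h) sin (a y)\<close>, and it vanishes at both ends because \<open>h\<close> and the sine do.
\<close>

lemma sine_by_parts:
  fixes h h' h'' :: "real \<Rightarrow> real"
  assumes h: "\<And>x. x \<in> {0..1} \<Longrightarrow> (h has_real_derivative h' x) (at x within {0..1})"
    and h': "\<And>x. x \<in> {0..1} \<Longrightarrow> (h' has_real_derivative h'' x) (at x within {0..1})"
    and "h 0 = 0" "h 1 = 0"
    and c: "continuous_on {0..1} h''"
  shows "integral {0..1} (\<lambda>y. h'' y * sin (freq n * y)) =
    - (freq n)\<^sup>2 * integral {0..1} (\<lambda>y. h y * sin (freq n * y))"
proof -
  let ?a = "freq n"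
  let ?G = "\<lambda>y. h' y * sin (?a * y) - h y * (?a * cos (?a * y))"
  have ch: "continuous_on {0..1} h"
    using h by (intro DERIV_continuous_on) auto
  have d: "(?G has_real_derivative (h'' y * sin (?a * y) + ?a\<^sup>2 * (h y * sin (?a * y))))
      (at y within {0..1})" if "y \<in> {0..1}" for y
    using h[OF that] h'[OF that]
    by (auto intro!: derivative_eq_intros simp: algebra_simps power2_eq_square)
  have "((\<lambda>y. h'' y * sin (?a * y) + ?a\<^sup>2 * (h y * sin (?a * y))) has_integral ?G 1 - ?G 0) {0..1}"
    by (intro fundamental_theorem_of_calculus)
      (auto simp: has_real_derivative_iff_has_vector_derivative[symmetric] intro!: d)
  then have "integral {0..1} (\<lambda>y. h'' y * sin (?a * y) + ?a\<^sup>2 * (h y * sin (?a * y))) = 0"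
    using assms(3,4) by (simp add: integral_unique)
  moreover have "integral {0..1} (\<lambda>y. h'' y * sin (?a * y) + ?a\<^sup>2 * (h y * sin (?a * y))) =
     integral {0..1} (\<lambda>y. h'' y * sin (?a * y)) + integral {0..1} (\<lambda>y. ?a\<^sup>2 * (h y * sin (?a * y)))"
    by (intro integral_add integrable_continuous_interval continuous_intros c ch)
  ultimately show ?thesis by simp
qed

text \<open>
  Off the diagonal, \<open>sine_by_parts\<close> applied to one of the two modes evaluates the same integral with
  two different eigenvalues as factor.
\<close>

lemma sine_orthogonal:
  "integral {0..1} (\<lambda>y. sin (freq k * y) * sin (freq n * y)) = (if k = n then 1 / 2 else 0)"
proof (cases "k = n")
  case True
  let ?a = "freq n"
  have [simp]: "?a \<noteq> 0" using freq_pos[of n] by simp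
  have "((\<lambda>y. sin (?a * y) * sin (?a * y)) has_integral
      (1 / 2 - sin (?a * 1) * cos (?a * 1) / (2 * ?a)) - (0 / 2 - sin (?a * 0) * cos (?a * 0) / (2 * ?a))) {0..1}"
  proof (intro fundamental_theorem_of_calculus)
    fix y :: real
    have "(cos (?a * y))\<^sup>2 = 1 - (sin (?a * y))\<^sup>2" by (simp add: cos_squared_eq)
    then have "((\<lambda>y. y / 2 - sin (?a * y) * cos (?a * y) / (2 * ?a)) has_real_derivative
        sin (?a * y) * sin (?a * y)) (at y within {0..1})"
      by (auto intro!: derivative_eq_intros simp: divide_simps) (simp add: algebra_simps power2_eq_square, simp flip: distrib_left)
    then show "((\<lambda>y. y / 2 - sin (?a * y) * cos (?a * y) / (2 * ?a)) has_vector_derivative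
        sin (?a * y) * sin (?a * y)) (at y within {0..1})"
      by (simp add: has_real_derivative_iff_has_vector_derivative)
  qed simp
  then show ?thesis using True by (simp add: integral_unique)
next
  case False
  let ?I = "integral {0..1} (\<lambda>y. sin (freq k * y) * sin (freq n * y))"
  have "integral {0..1} (\<lambda>y. (- (freq k)\<^sup>2 * sin (freq k * y)) * sin (freq n * y)) = - (freq n)\<^sup>2 * ?I"
    by (rule sine_by_parts[where h' = "\<lambda>y. freq k * cos (freq k * y)"])
      (auto intro!: derivative_eq_intros continuous_intros simp: power2_eq_square)
  moreover have "integral {0..1} (\<lambda>y. (- (freq k)\<^sup>2 * sin (freq k * y)) * sin (freq n * y))
     = - (freq k)\<^sup>2 * ?I"
    unfolding mult.assoc by (rule integral_mult_right)
  ultimately have "((freq n)\<^sup>2 - (freq k)\<^sup>2) * ?I = 0" by (simp add: algebra_simps)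
  moreover have "(freq n)\<^sup>2 \<noteq> (freq k)\<^sup>2"
    using False freq_pos[of n] freq_pos[of k] by (auto simp: power2_eq_iff freq_eq_iff)
  ultimately show ?thesis using False by simp
qed

text \<open>
  The product formula for \<open>sin (k \<pi> y) cos (\<pi> y)\<close> shows that \<open>h\<close> is orthogonal to \<open>sin (\<pi> y) p (cos (\<pi> y))\<close>
  for each polynomial \<open>p\<close>. Since \<open>cos (\<pi> y)\<close> is injective on the unit interval, Weierstrass' theorem
  provides polynomials for which \<open>p (cos (\<pi> y))\<close> approximates \<open>h\<close> itself, so the integral of
  \<open>h\<^sup>2 sin (\<pi> y)\<close> is zero.
\<close>

lemma sine_complete:
  fixes h :: "real \<Rightarrow> real"
  assumes c: "continuous_on {0..1} h"
    and z: "\<And>n. integral {0..1} (\<lambda>y. h y * sin (freq n * y)) = 0"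
    and x: "x \<in> {0<..<1}"
  shows "h x = 0"
proof -
  have z': "integral {0..1} (\<lambda>y. h y * sin (real k * pi * y)) = 0" for k
    using z[of "k - 1"] by (cases k) (auto simp: freq_def)
  have mono: "integral {0..1} (\<lambda>y. h y * (sin (real (Suc k) * pi * y) * cos (pi * y) ^ j)) = 0" for j k
  proof (induction j arbitrary: k)
    case 0
    show ?case using z'[of "Suc k"] by simp
  next
    case (Suc j)
    have eq: "h y * (sin (real (Suc k) * pi * y) * cos (pi * y) ^ Suc j) =
       1/2 * (h y * (sin (real (Suc (Suc k)) * pi * y) * cos (pi * y) ^ j)) +
       1/2 * (h y * (sin (real k * pi * y) * cos (pi * y) ^ j))" for y
    proof -
      have "sin (real (Suc (Suc k)) * pi * y) = sin (real (Suc k) * pi * y + pi * y)"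
        "sin (real k * pi * y) = sin (real (Suc k) * pi * y - pi * y)"
        by (auto simp: algebra_simps)
      then have "sin (real (Suc (Suc k)) * pi * y) + sin (real k * pi * y)
          = 2 * (sin (real (Suc k) * pi * y) * cos (pi * y))"
        by (simp only: sin_add sin_diff)
      then have e: "sin (real (Suc k) * pi * y) * cos (pi * y) =
         (sin (real (Suc (Suc k)) * pi * y) + sin (real k * pi * y)) / 2" by simp
      have "h y * (sin (real (Suc k) * pi * y) * cos (pi * y) ^ Suc j) =
         h y * ((sin (real (Suc k) * pi * y) * cos (pi * y)) * cos (pi * y) ^ j)"
        by simp
      also have "\<dots> = h y * ((sin (real (Suc (Suc k)) * pi * y) + sin (real k * pi * y)) / 2 * cos (pi * y) ^ j)"
        by (simp only: e)
      finally show ?thesis by (simp add: algebra_simps)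
    qed
    have k0: "integral {0..1} (\<lambda>y. h y * (sin (real k * pi * y) * cos (pi * y) ^ j)) = 0"
      using Suc.IH by (cases k) auto
    show ?case
      unfolding eq
      by (subst integral_add, (intro integrable_continuous_interval continuous_intros c)+)
        (simp only: integral_mult_right Suc.IH k0 mult_zero_right add_0)
  qed
  have poly: "integral {0..1} (\<lambda>y. h y * (sin (pi * y) * p (cos (pi * y)))) = 0"
    if "real_polynomial_function p" for p
  proof -
    obtain a n where p: "p = (\<lambda>x. \<Sum>i\<le>n. a i * x ^ i)"
      using real_polynomial_function_imp_sum[OF \<open>real_polynomial_function p\<close>] by blast
    have eq: "(\<lambda>y. h y * (sin (pi * y) * p (cos (pi * y)))) =
       (\<lambda>y. \<Sum>i\<le>n. a i * (h y * (sin (real (Suc 0) * pi * y) * cos (pi * y) ^ i)))"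
      by (auto simp: p sum_distrib_left mult_ac)
    have "integral {0..1} (\<lambda>y. h y * (sin (pi * y) * p (cos (pi * y)))) =
       (\<Sum>i\<le>n. integral {0..1} (\<lambda>y. a i * (h y * (sin (real (Suc 0) * pi * y) * cos (pi * y) ^ i))))"
      unfolding eq by (rule integral_sum) (auto intro!: integrable_continuous_interval continuous_intros c)
    also have "\<dots> = 0"
      by (intro sum.neutral ballI) (simp only: integral_mult_right mono mult_zero_right)
    finally show ?thesis .
  qed
  define Q where "Q = integral {0..1} (\<lambda>y. h y * h y * sin (pi * y))"
  obtain K where K: "\<And>y. y \<in> {0..1} \<Longrightarrow> \<bar>h y\<bar> \<le> K" and "K > 0"
    using compact_imp_bounded[OF compact_continuous_image[OF c compact_Icc]]
    unfolding bounded_pos by (metis imageI real_norm_def)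
  have small: "\<bar>Q\<bar> \<le> K * e" if e: "e > 0" for e
  proof -
    \<comment> \<open>\<open>h\<close> as a function of \<open>z = cos (\<pi> y)\<close>\<close>
    have "continuous_on {-1..1} (\<lambda>z. h (arccos z / pi))"
      using arccos_lbound arccos_ubound
      by (intro continuous_on_compose2[OF c] continuous_intros) (auto simp: divide_simps)
    then obtain p where p: "real_polynomial_function p"
      and pe: "\<And>z. z \<in> {-1..1} \<Longrightarrow> \<bar>h (arccos z / pi) - p z\<bar> < e"
      using Stone_Weierstrass_real_polynomial_function[OF compact_Icc _ e] by metis
    have pc: "continuous_on S (\<lambda>y. p (g y))" if "continuous_on S g" for S and g :: "real \<Rightarrow> real"
      by (rule continuous_on_compose2[OF continuous_on_polymonial_function[of p UNIV] that])
        (use p in \<open>auto simp: real_polynomial_function_eq\<close>)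
    have "Q = integral {0..1} (\<lambda>y. h y * h y * sin (pi * y)) -
      integral {0..1} (\<lambda>y. h y * (sin (pi * y) * p (cos (pi * y))))"
      by (simp add: Q_def poly[OF p])
    also have "\<dots> = integral {0..1} (\<lambda>y. h y * h y * sin (pi * y) - h y * (sin (pi * y) * p (cos (pi * y))))"
      by (rule integral_diff[symmetric]) (intro integrable_continuous_interval continuous_intros c pc)+
    also have "norm \<dots> \<le> K * e * (1 - 0)"
    proof (rule integral_bound)
      show "continuous_on {0..1} (\<lambda>y. h y * h y * sin (pi * y) - h y * (sin (pi * y) * p (cos (pi * y))))"
        by (intro continuous_intros c pc)
      fix y :: real assume y: "y \<in> {0..1}"
      have "arccos (cos (pi * y)) = pi * y"
        using y by (intro arccos_cos) (auto simp: mult_le_cancel_left1)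
      then have "\<bar>h y - p (cos (pi * y))\<bar> \<le> e"
        using pe[of "cos (pi * y)"] by simp
      then have "\<bar>h y\<bar> * (\<bar>h y - p (cos (pi * y))\<bar> * \<bar>sin (pi * y)\<bar>) \<le> K * (e * 1)"
        using K[OF y] \<open>K > 0\<close> \<open>e > 0\<close> by (intro mult_mono) auto
      also have "\<bar>h y\<bar> * (\<bar>h y - p (cos (pi * y))\<bar> * \<bar>sin (pi * y)\<bar>) =
          norm (h y * h y * sin (pi * y) - h y * (sin (pi * y) * p (cos (pi * y))))"
        by (simp add: abs_mult[symmetric] algebra_simps)
      finally show "norm (h y * h y * sin (pi * y) - h y * (sin (pi * y) * p (cos (pi * y)))) \<le> K * e"
        by simp
    qed simp
    finally show ?thesis by simp
  qed
  have "\<bar>Q\<bar> \<le> 0"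
  proof (rule field_le_epsilon)
    fix e :: real assume "e > 0"
    then show "\<bar>Q\<bar> \<le> 0 + e" using small[of "e / K"] \<open>K > 0\<close> by simp
  qed
  then have "Q = 0" by simp
  have "\<forall>y\<in>{0..1}. h y * h y * sin (pi * y) = 0"
  proof (subst integral_eq_0_iff[symmetric])
    show "continuous_on {0..1} (\<lambda>y. h y * h y * sin (pi * y))"
      by (intro continuous_intros c)
    show "h y * h y * sin (pi * y) \<ge> 0" if "y \<in> {0..1}" for y
      using that by (intro mult_nonneg_nonneg sin_ge_zero zero_le_square)
         (auto simp: mult_le_cancel_left1)
    show "integral {0..1} (\<lambda>y. h y * h y * sin (pi * y)) = 0" using \<open>Q = 0\<close> by (simp add: Q_def)
  qed simp
  moreover have "sin (pi * x) > 0"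
    using x by (intro sin_gt_zero) auto
  ultimately show ?thesis using x by force
qed

lemma sine_coeff_bound:
  fixes h h' h'' :: "real \<Rightarrow> real"
  assumes h: "\<And>x. x \<in> {0..1} \<Longrightarrow> (h has_real_derivative h' x) (at x within {0..1})"
    and h': "\<And>x. x \<in> {0..1} \<Longrightarrow> (h' has_real_derivative h'' x) (at x within {0..1})"
    and h0: "h 0 = 0" "h 1 = 0"
    and c: "continuous_on {0..1} h''"
    and B: "\<And>x. x \<in> {0..1} \<Longrightarrow> \<bar>h'' x\<bar> \<le> B"
  shows "\<bar>sine_coeff h n\<bar> \<le> 2 * B / (freq n)\<^sup>2"
proof -
  have a: "(freq n)\<^sup>2 > 0" using freq_pos[of n] by simp
  have "norm (integral {0..1} (\<lambda>y. h'' y * sin (freq n * y))) \<le> B * (1 - 0)"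
  proof (rule integral_bound)
    show "norm (h'' y * sin (freq n * y)) \<le> B" if "y \<in> {0..1}" for y
      using mult_mono[OF B[OF that] abs_sin_le_one[of "freq n * y"]] B[OF that]
      by (simp add: abs_mult)
  qed (auto intro!: continuous_intros c)
  moreover have "integral {0..1} (\<lambda>y. h'' y * sin (freq n * y)) =
      - (freq n)\<^sup>2 * integral {0..1} (\<lambda>y. h y * sin (freq n * y))"
    by (rule sine_by_parts[OF h h' h0 c])
  ultimately have "(freq n)\<^sup>2 * \<bar>integral {0..1} (\<lambda>y. h y * sin (freq n * y))\<bar> \<le> B"
    by (simp add: abs_mult)
  then show ?thesis
    using a by (simp add: sine_coeff_def abs_mult field_simps)
qed

text \<open>
  The sine series converges uniformly to some continuous function, which has the same sine
  coefficients as \<open>h\<close> by orthogonality; completeness then identifies it with \<open>h\<close>.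
\<close>

lemma sine_series:
  fixes h h' h'' :: "real \<Rightarrow> real"
  assumes h: "\<And>x. x \<in> {0..1} \<Longrightarrow> (h has_real_derivative h' x) (at x within {0..1})"
    and h': "\<And>x. x \<in> {0..1} \<Longrightarrow> (h' has_real_derivative h'' x) (at x within {0..1})"
    and h0: "h 0 = 0" "h 1 = 0"
    and c: "continuous_on {0..1} h''"
    and B: "\<And>x. x \<in> {0..1} \<Longrightarrow> \<bar>h'' x\<bar> \<le> B"
    and x: "x \<in> {0..1}"
  shows "(\<lambda>n. sine_coeff h n * sin (freq n * x)) sums h x"
proof -
  let ?b = "sine_coeff h"
  let ?S = "\<lambda>y. \<Sum>n. ?b n * sin (freq n * y)"
  have s: "summable (\<lambda>n. 2 * B / (freq n)\<^sup>2)"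
    using summable_mult[OF summable_inverse_freq_sq, of "2 * B"] by simp
  have bd: "norm (?b n * sin (freq n * y)) \<le> 2 * B / (freq n)\<^sup>2" for n y
    using mult_mono[OF sine_coeff_bound[OF h h' h0 c B] abs_sin_le_one[of "freq n * y"]]
      sine_coeff_bound[OF h h' h0 c B, of n]
    by (simp add: abs_mult)
  have ch: "continuous_on {0..1} h"
    using h by (intro DERIV_continuous_on) auto
  have cS: "continuous_on {0..1} ?S"
    using bd s by (intro series_of_continuous(2)[where B = "\<lambda>n. 2 * B / (freq n)\<^sup>2"] continuous_intros)
  have sm: "summable (\<lambda>n. ?b n * sin (freq n * y))" for y
    using bd s by (intro summable_comparison_test[OF _ s]) auto
  have "integral {0..1} (\<lambda>y. (h y - ?S y) * sin (freq k * y)) = 0" for k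
  proof -
    have "(\<lambda>n. integral {0..1} (\<lambda>y. ?b n * sin (freq n * y) * sin (freq k * y))) sums
      integral {0..1} (\<lambda>y. \<Sum>n. ?b n * sin (freq n * y) * sin (freq k * y))"
    proof (rule integral_series_of_continuous[OF _ _ s])
      show "norm (?b n * sin (freq n * y) * sin (freq k * y)) \<le> 2 * B / (freq n)\<^sup>2" for n y
        using mult_mono[OF bd[of n y] abs_sin_le_one[of "freq k * y"]] order.trans[OF norm_ge_zero bd[of n y]]
        by (simp add: abs_mult)
    qed (intro continuous_intros)
    moreover have "(\<lambda>n. integral {0..1} (\<lambda>y. ?b n * sin (freq n * y) * sin (freq k * y)))
       = (\<lambda>n. if n = k then ?b k / 2 else 0)"
      by (simp add: mult.assoc sine_orthogonal fun_eq_iff)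
    moreover have "(\<lambda>n. if n = k then ?b k / 2 else 0) sums (?b k / 2)"
      using sums_single[of k "\<lambda>_. ?b k / 2"] by simp
    moreover have "(\<Sum>n. ?b n * sin (freq n * y) * sin (freq k * y)) = ?S y * sin (freq k * y)" for y
      by (rule suminf_mult2[OF sm, symmetric])
    ultimately have "integral {0..1} (\<lambda>y. ?S y * sin (freq k * y)) = ?b k / 2"
      by (auto dest: sums_unique2)
    moreover have "integral {0..1} (\<lambda>y. (h y - ?S y) * sin (freq k * y)) =
       integral {0..1} (\<lambda>y. h y * sin (freq k * y)) - integral {0..1} (\<lambda>y. ?S y * sin (freq k * y))"
      unfolding left_diff_distrib
      by (intro integral_diff integrable_continuous_interval continuous_intros ch cS)
    ultimately show ?thesis by (simp add: sine_coeff_def)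
  qed
  then have "h y - ?S y = 0" if "y \<in> {0<..<1}" for y
    using that by (intro sine_complete[of "\<lambda>y. h y - ?S y"] continuous_intros ch cS) auto
  moreover have "h 0 - ?S 0 = 0" "h 1 - ?S 1 = 0" using h0 by auto
  ultimately have "h x - ?S x = 0"
    using x by (cases "x = 0 \<or> x = 1") auto
  then show ?thesis using summable_sums[OF sm[of x]] by simp
qed

section \<open>Laplace inversion of a simple fraction\<close>

text \<open>The truncated inverse Laplace transform of \<open>1 / (z + lam)\<close> along the imaginary axis, up to
  the factor \<open>1 / (2 \<pi>)\<close>.\<close>

definition bromwich :: "real \<Rightarrow> real \<Rightarrow> real \<Rightarrow> complex" where
  "bromwich \<tau> lam M = integral {-M..M} (\<lambda>r. exp (\<i> * of_real r * of_real \<tau>) / (\<i> * of_real r + of_real lam))"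

lemma norm_ir_plus:
  "(norm (\<i> * of_real r + of_real lam))\<^sup>2 = r\<^sup>2 + lam\<^sup>2"
  by (simp add: cmod_power2)

lemma ir_plus_nonzero: "lam > 0 \<Longrightarrow> \<i> * of_real r + of_real lam \<noteq> 0"
  by (auto simp: complex_eq_iff)

text \<open>
  The integral converges only conditionally as \<open>M\<close> grows. Integrating the oscillating factor trades
  a factor \<open>1 / \<tau>\<close> for an absolutely convergent integral and boundary terms of order \<open>1 / M\<close>.
\<close>

lemma bromwich_by_parts:
  assumes "\<tau> > 0" "lam > 0" "M \<ge> 0"
  shows "bromwich \<tau> lam M =
    exp (\<i> * of_real M * of_real \<tau>) / (\<i> * of_real \<tau> * (\<i> * of_real M + of_real lam)) -
    exp (- \<i> * of_real M * of_real \<tau>) / (\<i> * of_real \<tau> * (- \<i> * of_real M + of_real lam)) +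
    1 / of_real \<tau> * integral {-M..M} (\<lambda>r. exp (\<i> * of_real r * of_real \<tau>) / (\<i> * of_real r + of_real lam)\<^sup>2)"
proof -
  let ?G = "\<lambda>z. exp (\<i> * z * of_real \<tau>) / (\<i> * of_real \<tau> * (\<i> * z + of_real lam))"
  let ?f = "\<lambda>r. exp (\<i> * of_real r * of_real \<tau>) / (\<i> * of_real r + of_real lam)"
  let ?g = "\<lambda>r. exp (\<i> * of_real r * of_real \<tau>) / (\<i> * of_real r + of_real lam)\<^sup>2"
  note nz = ir_plus_nonzero[OF assms(2)]
  have "((\<lambda>r. ?f r - 1 / of_real \<tau> * ?g r) has_integral ?G (of_real M) - ?G (of_real (- M))) {-M..M}"
  proof (rule fundamental_theorem_of_calculus)
    fix r assume "r \<in> {-M..M}"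
    show "((\<lambda>r. ?G (of_real r)) has_vector_derivative ?f r - 1 / of_real \<tau> * ?g r) (at r within {- M..M})"
    proof (rule has_vector_derivative_real_field)
      define w where "w = \<i> * of_real r + of_real lam"
      define E where "E = exp (\<i> * of_real r * of_real \<tau>)"
      have "w \<noteq> 0" using nz[of r] by (simp add: w_def)
      have "(?G has_field_derivative (E * (\<i> * of_real \<tau>) * (\<i> * of_real \<tau> * w) - E * (\<i> * of_real \<tau> * \<i>)) /
          ((\<i> * of_real \<tau> * w) * (\<i> * of_real \<tau> * w))) (at (of_real r))"
        unfolding E_def w_def using nz[of r] assms(1)
        by (auto intro!: derivative_eq_intros) (simp add: algebra_simps)
      also have "(E * (\<i> * of_real \<tau>) * (\<i> * of_real \<tau> * w) - E * (\<i> * of_real \<tau> * \<i>)) /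
          ((\<i> * of_real \<tau> * w) * (\<i> * of_real \<tau> * w)) = E / w - 1 / of_real \<tau> * (E / w\<^sup>2)"
        using \<open>w \<noteq> 0\<close> assms(1) by (simp add: divide_simps power2_eq_square) (simp add: algebra_simps)
      finally show "(?G has_field_derivative ?f r - 1 / of_real \<tau> * ?g r) (at (of_real r))"
        by (simp add: w_def E_def)
    qed
  qed (use assms in auto)
  then have "integral {-M..M} (\<lambda>r. ?f r - 1 / of_real \<tau> * ?g r) = ?G (of_real M) - ?G (of_real (- M))"
    by (rule integral_unique)
  moreover have "integral {-M..M} (\<lambda>r. ?f r - 1 / of_real \<tau> * ?g r) =
      integral {-M..M} ?f - integral {-M..M} (\<lambda>r. 1 / of_real \<tau> * ?g r)"
    using nz by (intro integral_diff integrable_continuous_interval continuous_intros) auto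
  moreover have "integral {-M..M} (\<lambda>r. 1 / of_real \<tau> * ?g r) = 1 / of_real \<tau> * integral {-M..M} ?g"
    by (rule integral_mult_right)
  ultimately have "integral {-M..M} ?f = ?G (of_real M) - ?G (of_real (- M)) + 1 / of_real \<tau> * integral {-M..M} ?g"
    by (simp only: diff_eq_eq)
  then show ?thesis by (simp add: bromwich_def)
qed

text \<open>
  After the integration by parts the denominators have modulus at least \<open>lam \<ge> 1\<close>, and the remaining
  integrand is dominated by \<open>1 / (1 + r\<^sup>2)\<close>, whose integral over the line is \<open>\<pi>\<close>.
\<close>

lemma bromwich_bound:
  assumes "\<tau> > 0" "lam \<ge> 1" "M \<ge> 0"
  shows "norm (bromwich \<tau> lam M) \<le> (2 + pi) / \<tau>"
proof -
  let ?g = "\<lambda>r. exp (\<i> * of_real r * of_real \<tau>) / (\<i> * of_real r + of_real lam)\<^sup>2"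
  have lam: "lam > 0" "lam\<^sup>2 \<ge> 1" using assms by auto
  have ng: "norm (?g r) \<le> inverse (1 + r\<^sup>2)" for r
  proof -
    have "inverse (r\<^sup>2 + lam\<^sup>2) \<le> inverse (1 + r\<^sup>2)"
      using lam by (intro le_imp_inverse_le) (auto simp: add_pos_nonneg)
    then show ?thesis by (simp add: norm_divide norm_power norm_ir_plus inverse_eq_divide)
  qed
  have gi: "?g integrable_on {-M..M}"
    using ir_plus_nonzero[OF lam(1)] by (auto intro!: integrable_continuous_interval continuous_intros)
  have arc: "((\<lambda>r. inverse (1 + r\<^sup>2)) has_integral arctan M - arctan (- M)) {-M..M}"
    using assms by (intro fundamental_theorem_of_calculus)
      (auto simp: has_real_derivative_iff_has_vector_derivative[symmetric] intro!: derivative_eq_intros)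
  have "norm (integral {-M..M} ?g) \<le> arctan M - arctan (- M)"
    using integral_norm_bound_integral[OF gi has_integral_integrable[OF arc] ng]
    by (simp only: integral_unique[OF arc])
  also have "\<dots> \<le> pi" using arctan_ubound[of M] by (simp add: arctan_minus)
  finally have I: "norm (1 / of_real \<tau> * integral {-M..M} ?g) \<le> pi / \<tau>"
    using assms by (simp add: norm_mult norm_divide divide_right_mono)
  have n1: "norm (\<i> * of_real r + of_real lam) \<ge> 1" for r
    using complex_Re_le_cmod[of "\<i> * of_real r + of_real lam"] assms by simp
  have b: "norm (exp (\<i> * of_real r * of_real \<tau>) / (\<i> * of_real \<tau> * (\<i> * of_real r + of_real lam))) \<le> 1 / \<tau>" for r
    using n1[of r] assms(1) by (auto simp: norm_divide norm_mult divide_simps)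
  show ?thesis
    unfolding bromwich_by_parts[OF assms(1) lam(1) assms(3)]
    using norm_triangle_le[OF add_mono[OF norm_triangle_le_diff[OF add_mono[OF b[of M] b[of "-M"]]] I]]
    by (simp add: add_divide_distrib)
qed

text \<open>
  Cauchy's formula on the circle of radius \<open>M > lam\<close> gives the value \<open>2 \<pi> \<i> \<tau> exp (- lam \<tau>)\<close>. The integrand has
  a primitive in the half plane to the right of its pole, so the right half of the circle may be
  replaced by the segment from \<open>- \<i> M\<close> to \<open>\<i> M\<close>. On the left half the exponential is bounded by 1, and the
  squared denominator makes the contribution \<open>O(1 / M)\<close>.
\<close>

lemma bromwich_squared_limit:
  assumes "\<tau> > 0" "lam > 0"
  shows "((\<lambda>M. integral {-M..M} (\<lambda>r. exp (\<i> * of_real r * of_real \<tau>) / (\<i> * of_real r + of_real lam)\<^sup>2))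
     \<longlongrightarrow> of_real (2 * pi * \<tau> * exp (- lam * \<tau>))) at_top"
proof -
  let ?I = "\<lambda>M. integral {-M..M} (\<lambda>r. exp (\<i> * of_real r * of_real \<tau>) / (\<i> * of_real r + of_real lam)\<^sup>2)"
  define f :: "complex \<Rightarrow> complex" where "f z = exp (z * of_real \<tau>) / (z - (- of_real lam))\<^sup>2" for z
  define S where "S = {z. Re z > - lam}"
  have "z - (- of_real lam) \<noteq> 0" if "z \<in> S" for z
    using that by (auto simp: S_def complex_eq_iff)
  then have "f holomorphic_on S"
    unfolding f_def by (intro holomorphic_intros) auto
  moreover have "open S" "convex S"
    unfolding S_def by (auto simp: open_halfspace_Re_gt convex_halfspace_Re_gt)
  ultimately obtain P where P: "\<And>z. z \<in> S \<Longrightarrow> (P has_field_derivative f z) (at z within S)"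
    using holomorphic_convex_primitive' by blast
  have prim: "contour_integral (part_circlepath 0 M a b) f = P (M * exp (\<i> * b)) - P (M * exp (\<i> * a))"
    if "\<And>t. t \<in> {a..b} \<Longrightarrow> cos t \<ge> 0" "a < b" "M > 0" for a b M :: real
  proof -
    have "(f has_contour_integral P (pathfinish (part_circlepath 0 M a b)) -
        P (pathstart (part_circlepath 0 M a b))) (part_circlepath 0 M a b)"
    proof (rule contour_integral_primitive[where S = S, OF P])
      show "path_image (part_circlepath 0 M a b) \<subseteq> S"
        using that(1,2,3) assms
        by (auto simp: path_image_part_circlepath' S_def closed_segment_eq_real_ivl
            intro!: less_le_trans[OF _ mult_nonneg_nonneg])
    qed auto
    then show ?thesis by (simp add: contour_integral_unique)
  qed
  have main: "norm (?I M - of_real (2 * pi * \<tau> * exp (- lam * \<tau>))) \<le> pi * M / (M - lam)\<^sup>2"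
    if M: "M > lam" for M
  proof -
    let ?arc = "contour_integral (part_circlepath 0 M (pi/2) (3 * pi/2)) f"
    have M0: "M > 0" using M assms by simp
    have "(f has_contour_integral 2 * pi * \<i> * deriv (\<lambda>z. exp (z * of_real \<tau>)) (- of_real lam)) (circlepath 0 M)"
    proof -
      have "((\<lambda>z. exp (z * of_real \<tau>) / (z - (- of_real lam)) ^ Suc 1) has_contour_integral
          2 * pi * \<i> / fact 1 * (deriv ^^ 1) (\<lambda>z. exp (z * of_real \<tau>)) (- of_real lam)) (circlepath 0 M)"
        using M assms by (intro Cauchy_has_contour_integral_higher_derivative_circlepath
          continuous_intros holomorphic_intros) auto
      moreover have "f = (\<lambda>z. exp (z * of_real \<tau>) / (z - (- of_real lam)) ^ Suc 1)"
        by (simp add: f_def fun_eq_iff power2_eq_square)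
      ultimately show ?thesis by simp
    qed
    moreover have "deriv (\<lambda>z::complex. exp (z * of_real \<tau>)) (- of_real lam) = of_real (\<tau> * exp (- lam * \<tau>))"
      by (rule DERIV_imp_deriv) (auto intro!: derivative_eq_intros simp: exp_of_real[symmetric])
    ultimately have circ: "(f has_contour_integral \<i> * of_real (2 * pi * \<tau> * exp (- lam * \<tau>))) (part_circlepath 0 M 0 (2 * pi))"
      by (simp add: circlepath_def mult_ac)
    let ?G = "\<lambda>t. f (0 + M * cis t) * M * \<i> * cis t"
    have G: "(?G has_integral \<i> * of_real (2 * pi * \<tau> * exp (- lam * \<tau>))) {0..2*pi}"
      using circ by (subst (asm) has_contour_integral_part_circlepath_iff) auto
    then have Gi: "?G integrable_on {0..2*pi}" by auto
    \<comment> \<open>the parametrisation starts at angle 0, so the right half circle comes in two pieces\<close>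
    have "integral {0..2*pi} ?G = integral {0..pi/2} ?G + integral {pi/2..2*pi} ?G"
      by (rule Henstock_Kurzweil_Integration.integral_combine[symmetric, OF _ _ Gi]) auto
    also have "integral {pi/2..2*pi} ?G = integral {pi/2..3*pi/2} ?G + integral {3*pi/2..2*pi} ?G"
      by (rule Henstock_Kurzweil_Integration.integral_combine[symmetric,
            OF _ _ integrable_subinterval_real[OF Gi]]) auto
    also have "integral {pi/2..3*pi/2} ?G = ?arc"
      by (rule contour_integral_part_circlepath_eq[symmetric]) auto
    also have "integral {0..pi/2} ?G = contour_integral (part_circlepath 0 M 0 (pi/2)) f"
      by (rule contour_integral_part_circlepath_eq[symmetric]) auto
    also have "\<dots> = P (M * exp (\<i> * (pi/2))) - P (M * exp (\<i> * 0))"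
    proof -
      have "cos t \<ge> 0" if "t \<in> {0..pi/2}" for t
        using that by (intro cos_ge_zero) auto
      then show ?thesis using prim[OF _ _ M0, of 0 "pi/2"] by simp
    qed
    also have "integral {3*pi/2..2*pi} ?G = contour_integral (part_circlepath 0 M (3*pi/2) (2*pi)) f"
      by (rule contour_integral_part_circlepath_eq[symmetric]) auto
    also have "\<dots> = P (M * exp (\<i> * (2*pi))) - P (M * exp (\<i> * (3*pi/2)))"
    proof -
      have "cos t \<ge> 0" if "t \<in> {3*pi/2..2*pi}" for t
      proof -
        have "cos (t - 2 * pi) \<ge> 0" using that by (intro cos_ge_zero) auto
        then show ?thesis by (simp add: cos_diff)
      qed
      then show ?thesis using prim[OF _ _ M0, of "3*pi/2" "2*pi"] by auto
    qed
    finally have A: "integral {0..2*pi} ?G = P (M * exp (\<i> * (pi/2))) - P (M * exp (\<i> * 0)) + (?arc +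
       (P (M * exp (\<i> * (2*pi))) - P (M * exp (\<i> * (3*pi/2)))))" .
    have e: "exp (\<i> * (pi/2)) = \<i>" "exp (\<i> * (2*pi)) = 1" "exp (\<i> * (3*pi/2)) = - \<i>"
    proof -
      show "exp (\<i> * (pi/2)) = \<i>" "exp (\<i> * (2*pi)) = 1"
        by (auto simp: exp_eq_polar complex_eq_iff)
      have "\<i> * (3*pi/2) = \<i> * pi + \<i> * (pi/2)"
        by (simp add: field_simps)
      then show "exp (\<i> * (3*pi/2)) = - \<i>"
        using \<open>exp (\<i> * (pi/2)) = \<i>\<close> by (simp only: exp_add) simp
    qed
    have seg: "contour_integral (linepath (- \<i> * M) (\<i> * M)) f = P (\<i> * M) - P (- \<i> * M)"
    proof -
      have "(f has_contour_integral P (pathfinish (linepath (- \<i> * M) (\<i> * M))) -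
        P (pathstart (linepath (- \<i> * M) (\<i> * M)))) (linepath (- \<i> * M) (\<i> * M))"
      proof (rule contour_integral_primitive[where S = S, OF P])
        show "path_image (linepath (- \<i> * M) (\<i> * M)) \<subseteq> S"
          using assms \<open>convex S\<close> unfolding path_image_linepath
          by (intro closed_segment_subset) (auto simp: S_def)
      qed auto
      then show ?thesis by (simp add: contour_integral_unique)
    qed
    have "contour_integral (linepath (- \<i> * M) (\<i> * M)) f = \<i> * integral {-M..M} (\<lambda>r. f (Complex 0 r))"
      using M0 by (intro contour_integral_linepath_same_Re) auto
    also have "integral {-M..M} (\<lambda>r. f (Complex 0 r)) = ?I M"
      by (simp add: f_def Complex_eq)
    finally have "\<i> * ?I M = P (\<i> * M) - P (- \<i> * M)" using seg by simp
    moreover have "integral {0..2*pi} ?G = P (\<i> * M) - P (- \<i> * M) + ?arc"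
      unfolding A e by (simp add: mult.commute[of "complex_of_real M"])
    ultimately have "\<i> * of_real (2 * pi * \<tau> * exp (- lam * \<tau>)) = \<i> * ?I M + ?arc"
      by (simp only: integral_unique[OF G])
    then have "\<i> * (?I M - of_real (2 * pi * \<tau> * exp (- lam * \<tau>))) = - ?arc"
      by (simp add: algebra_simps)
    from arg_cong[OF this, of norm] have n: "norm (?I M - of_real (2 * pi * \<tau> * exp (- lam * \<tau>))) = norm ?arc"
      by (simp only: norm_mult norm_minus_cancel norm_ii mult_1)
    have "norm ?arc \<le> 1 / (M - lam)\<^sup>2 * M * \<bar>3 * pi/2 - pi/2\<bar>"
    proof (rule contour_integral_bound_part_circlepath)
      show "f contour_integrable_on part_circlepath 0 M (pi / 2) (3 * pi / 2)"
        using integrable_subinterval_real[OF Gi, of "pi/2" "3*pi/2"]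
        by (subst contour_integrable_part_circlepath_iff) auto
      fix z assume "z \<in> path_image (part_circlepath 0 M (pi / 2) (3 * pi / 2))"
      then obtain t where t: "pi/2 \<le> t" "t \<le> 3*pi/2" and z: "z = M * cis t"
        by (auto simp: path_image_part_circlepath' closed_segment_eq_real_ivl)
      have "cos (t - pi) \<ge> 0" using t by (intro cos_ge_zero) auto
      then have "cos t \<le> 0" by (simp add: cos_diff)
      then have 1: "norm (exp (z * of_real \<tau>)) \<le> 1"
        using M0 assms by (simp add: z mult_le_0_iff mult_nonneg_nonpos)
      have "norm z = M" using M0 by (simp add: z norm_mult)
      then have "M - lam \<le> norm (z - (- of_real lam))"
        using norm_triangle_ineq2[of z "- of_real lam"] assms by simp
      then have "(M - lam)\<^sup>2 \<le> (norm (z - (- of_real lam)))\<^sup>2"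
        using M by (intro power_mono) auto
      then show "norm (f z) \<le> 1 / (M - lam)\<^sup>2"
        unfolding f_def norm_divide norm_power using 1 M by (intro frac_le) auto
    qed (use M0 in auto)
    then show ?thesis using n by (simp add: mult_ac)
  qed
  have lim: "((\<lambda>M. pi * M / (M - lam)\<^sup>2) \<longlongrightarrow> 0) at_top" by real_asymp
  show ?thesis
    by (rule LIM_zero_cancel, rule Lim_null_comparison[OF _ lim])
       (use main in \<open>auto intro!: eventually_mono[OF eventually_gt_at_top[of lam]]\<close>)
qed

lemma bromwich_limit:
  assumes "\<tau> > 0" "lam > 0"
  shows "(bromwich \<tau> lam \<longlongrightarrow> of_real (2 * pi * exp (- lam * \<tau>))) at_top"
proof -
  let ?I = "\<lambda>M. integral {-M..M} (\<lambda>r. exp (\<i> * of_real r * of_real \<tau>) / (\<i> * of_real r + of_real lam)\<^sup>2)"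
  \<comment> \<open>the boundary terms of the integration by parts, at \<open>M\<close> for \<open>s = 1\<close> and at \<open>- M\<close> for \<open>s = - 1\<close>\<close>
  have z: "((\<lambda>M. exp (\<i> * of_real (s * M) * of_real \<tau>) / (\<i> * of_real \<tau> * (\<i> * of_real (s * M) + of_real lam))) \<longlongrightarrow> 0) at_top"
    if "\<bar>s\<bar> = 1" for s
  proof (rule Lim_null_comparison)
    show "\<forall>\<^sub>F M in at_top. norm (exp (\<i> * of_real (s * M) * of_real \<tau>) / (\<i> * of_real \<tau> * (\<i> * of_real (s * M) + of_real lam))) \<le> 1 / (\<tau> * M)"
      using eventually_gt_at_top[of 0]
    proof eventually_elim
      case (elim M)
      have "M = \<bar>Im (\<i> * of_real (s * M) + of_real lam)\<bar>" using elim that by (simp add: abs_mult)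
      also have "\<dots> \<le> norm (\<i> * of_real (s * M) + of_real lam)" by (rule abs_Im_le_cmod)
      finally show ?case
        using elim assms by (simp add: norm_divide norm_mult frac_le)
    qed
    show "((\<lambda>M. 1 / (\<tau> * M)) \<longlongrightarrow> 0) at_top" using assms by real_asymp
  qed
  let ?A = "\<lambda>s M. exp (\<i> * of_real (s * M) * of_real \<tau>) / (\<i> * of_real \<tau> * (\<i> * of_real (s * M) + of_real lam))"
  have "((\<lambda>M. ?A 1 M - ?A (-1) M + 1 / of_real \<tau> * ?I M) \<longlongrightarrow>
      0 - 0 + 1 / of_real \<tau> * of_real (2 * pi * \<tau> * exp (- lam * \<tau>))) at_top"
    by (rule tendsto_add[OF tendsto_diff[OF z z] tendsto_mult_left[OF bromwich_squared_limit[OF assms]]]) auto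
  moreover have "\<forall>\<^sub>F M in at_top. ?A 1 M - ?A (-1) M + 1 / of_real \<tau> * ?I M = bromwich \<tau> lam M"
    using eventually_ge_at_top[of 0]
    by eventually_elim (simp add: bromwich_by_parts[OF assms])
  ultimately have "(bromwich \<tau> lam \<longlongrightarrow> 0 - 0 + 1 / of_real \<tau> * of_real (2 * pi * \<tau> * exp (- lam * \<tau>))) at_top"
    by (rule Lim_transform_eventually)
  then show ?thesis
    using assms by (simp add: mult_ac)
qed

section \<open>The transform by the Green function\<close>

text \<open>
  All that matters about the kernel: it consists of two solutions of \<open>G'' = m\<^sup>2 G\<close>, vanishing at 0 and
  at 1 respectively, which agree at the diagonal point \<open>y = x\<close> while the derivative drops there by 1. In
  this form the case \<open>m = 0\<close> needs no separate treatment.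
\<close>

lemma green_pieces:
  assumes x: "x \<in> {0..1}" and m: "m = 0 \<or> sinh m \<noteq> 0"
  obtains L L' R R' :: "complex \<Rightarrow> complex" where
    "\<And>y. green m x y = (if y \<le> x then L (of_real y) else R (of_real y))"
    "\<And>z. (L has_field_derivative L' z) (at z)" "\<And>z. (L' has_field_derivative m\<^sup>2 * L z) (at z)"
    "\<And>z. (R has_field_derivative R' z) (at z)" "\<And>z. (R' has_field_derivative m\<^sup>2 * R z) (at z)"
    "L 0 = 0" "R 1 = 0" "L (of_real x) = R (of_real x)" "L' (of_real x) - R' (of_real x) = 1"
proof (cases "m = 0")
  case True
  show ?thesis
    by (rule that[where L = "\<lambda>z. of_real (1 - x) * z" and R = "\<lambda>z. of_real x * (1 - z)"
          and L' = "\<lambda>z. of_real (1 - x)" and R' = "\<lambda>z. - of_real x"])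
      (auto simp: True green_def intro!: derivative_eq_intros)
next
  case False
  define k where "k = - 1 / (m * sinh m)"
  have "sinh (m * of_real (x - 1)) * cosh (m * of_real x) - sinh (m * of_real x) * cosh (m * of_real (x - 1))
     = sinh (m * of_real (x - 1) - m * of_real x)"
    by (simp add: sinh_diff mult.commute)
  also have "m * of_real (x - 1) - m * of_real x = - m" by (simp add: algebra_simps)
  finally have w: "sinh (m * of_real (x - 1)) * cosh (m * of_real x) - sinh (m * of_real x) * cosh (m * of_real (x - 1)) = - sinh m"
    by simp
  show ?thesis
  proof (rule that[where L = "\<lambda>z. k * sinh (m * of_real (x - 1)) * sinh (m * z)"
        and R = "\<lambda>z. k * sinh (m * of_real x) * sinh (m * (z - 1))"
        and L' = "\<lambda>z. k * sinh (m * of_real (x - 1)) * (m * cosh (m * z))"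
        and R' = "\<lambda>z. k * sinh (m * of_real x) * (m * cosh (m * (z - 1)))"])
    show "k * sinh (m * of_real (x - 1)) * (m * cosh (m * of_real x)) -
        k * sinh (m * of_real x) * (m * cosh (m * (of_real x - 1))) = 1"
    proof -
      have "k * sinh (m * of_real (x - 1)) * (m * cosh (m * of_real x)) -
        k * sinh (m * of_real x) * (m * cosh (m * (of_real x - 1))) =
        k * m * (sinh (m * of_real (x - 1)) * cosh (m * of_real x) - sinh (m * of_real x) * cosh (m * of_real (x - 1)))"
        by (simp add: algebra_simps)
      also have "\<dots> = k * m * (- sinh m)" by (simp only: w)
      also have "\<dots> = 1" using False m by (simp add: k_def)
      finally show ?thesis .
    qed
  qed (use False m in \<open>auto simp: green_def k_def power2_eq_square intro!: derivative_eq_intros\<close>)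
qed

lemma continuous_on_green:
  assumes x: "x \<in> {0..1}" and m: "m = 0 \<or> sinh m \<noteq> 0"
  shows "continuous_on {0..1} (green m x)"
proof -
  obtain L L' R R' where g: "\<And>y. green m x y = (if y \<le> x then L (of_real y) else R (of_real y))"
    and L: "\<And>z. (L has_field_derivative L' z) (at z)"
    and R: "\<And>z. (R has_field_derivative R' z) (at z)"
    and e: "L (of_real x) = R (of_real x)"
    using green_pieces[OF x m] by metis
  have cL: "continuous_on UNIV L" and cR: "continuous_on UNIV R"
    using L R by (auto intro!: DERIV_continuous_on)
  have "continuous_on ({0..x} \<union> {x..1}) (\<lambda>y. if y \<le> x then L (of_real y) else R (of_real y))"
    using e by (intro continuous_on_cases continuous_on_compose2[OF cL] continuous_on_compose2[OF cR] continuous_intros) auto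
  moreover have "{0..x} \<union> {x..1} = {0..1}" using x by auto
  ultimately show ?thesis using g by (simp add: fun_eq_iff[of "green m x"] cong: continuous_on_cong)
qed

text \<open>
  If \<open>G'' = m\<^sup>2 G\<close>, then \<open>(G' sin (a y) - a G cos (a y)) / (m\<^sup>2 + a\<^sup>2)\<close> is a primitive of \<open>G sin (a y)\<close>. The
  boundary terms of the two pieces vanish at 0 and at 1, and at \<open>x\<close> only the jump of the derivative
  survives.
\<close>

lemma green_sine:
  assumes x: "x \<in> {0..1}" and m: "m = 0 \<or> sinh m \<noteq> 0" and nz: "m\<^sup>2 + of_real ((freq n)\<^sup>2) \<noteq> 0"
  shows "integral {0..1} (\<lambda>y. green m x y * of_real (sin (freq n * y))) =
    of_real (sin (freq n * x)) / (m\<^sup>2 + of_real ((freq n)\<^sup>2))"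
proof -
  obtain L L' R R' where g: "\<And>y. green m x y = (if y \<le> x then L (of_real y) else R (of_real y))"
    and L: "\<And>z. (L has_field_derivative L' z) (at z)" "\<And>z. (L' has_field_derivative m\<^sup>2 * L z) (at z)"
    and R: "\<And>z. (R has_field_derivative R' z) (at z)" "\<And>z. (R' has_field_derivative m\<^sup>2 * R z) (at z)"
    and b: "L 0 = 0" "R 1 = 0" and e: "L (of_real x) = R (of_real x)" and j: "L' (of_real x) - R' (of_real x) = 1"
    using green_pieces[OF x m] by metis
  let ?a = "complex_of_real (freq n)" and ?D = "m\<^sup>2 + of_real ((freq n)\<^sup>2)"
  define \<Phi> where "\<Phi> G G' z = (G' z * sin (?a * z) - ?a * G z * cos (?a * z)) / ?D" for G G' :: "complex \<Rightarrow> complex" and z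
  have piece: "((\<lambda>y. G (of_real y) * of_real (sin (freq n * y))) has_integral \<Phi> G G' (of_real d) - \<Phi> G G' (of_real c)) {c..d}"
    if "\<And>z. (G has_field_derivative G' z) (at z)" "\<And>z. (G' has_field_derivative m\<^sup>2 * G z) (at z)" "c \<le> d"
    for G G' :: "complex \<Rightarrow> complex" and c d :: real
  proof (rule fundamental_theorem_of_calculus[OF that(3)])
    fix y assume "y \<in> {c..d}"
    have "((\<Phi> G G') has_field_derivative G (of_real y) * sin (?a * of_real y)) (at (of_real y))"
      unfolding \<Phi>_def
      by (rule derivative_eq_intros that refl nz)+ (use nz in \<open>simp add: divide_simps\<close>, simp add: algebra_simps power2_eq_square)
    moreover have "sin (?a * of_real y) = of_real (sin (freq n * y))"
      by (simp flip: of_real_mult sin_of_real)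
    ultimately show "((\<lambda>y. \<Phi> G G' (of_real y)) has_vector_derivative G (of_real y) * of_real (sin (freq n * y))) (at y within {c..d})"
      by (metis has_vector_derivative_real_field)
  qed
  let ?g = "\<lambda>y. green m x y * of_real (sin (freq n * y))"
  have "(?g has_integral \<Phi> L L' (of_real x) - \<Phi> L L' (of_real 0)) {0..x}"
    using x by (intro has_integral_eq[OF _ piece[OF L]]) (auto simp: g)
  moreover have "(?g has_integral \<Phi> R R' (of_real 1) - \<Phi> R R' (of_real x)) {x..1}"
    using x e by (intro has_integral_eq[OF _ piece[OF R]]) (auto simp: g)
  ultimately have "(?g has_integral (\<Phi> L L' (of_real x) - \<Phi> L L' (of_real 0)) + (\<Phi> R R' (of_real 1) - \<Phi> R R' (of_real x))) {0..1}"
    using x by (intro has_integral_combine[of 0 x 1]) auto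
  moreover have "\<Phi> L L' (of_real 0) = 0" "\<Phi> R R' (of_real 1) = 0"
    using sin_freq[of n] by (auto simp: \<Phi>_def b sin_of_real)
  moreover have "\<Phi> L L' (of_real x) - \<Phi> R R' (of_real x) = of_real (sin (freq n * x)) / ?D"
  proof -
    have "\<Phi> L L' (of_real x) - \<Phi> R R' (of_real x) = (L' (of_real x) - R' (of_real x)) * sin (?a * of_real x) / ?D"
      unfolding \<Phi>_def e by (simp add: diff_divide_distrib[symmetric] algebra_simps)
    then show ?thesis by (simp add: j flip: of_real_mult sin_of_real)
  qed
  ultimately show ?thesis by (simp add: integral_unique)
qed

text \<open>
  The zeros of \<open>sinh\<close> are the \<open>k \<pi> \<i>\<close> with integer \<open>k\<close>, whose squares are real, and \<open>\<i> r\<close> is real only for \<open>r = 0\<close>.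
\<close>

lemma sinh_csqrt_nonzero:
  "csqrt (\<i> * of_real r) = 0 \<or> sinh (csqrt (\<i> * of_real r)) \<noteq> 0"
proof (rule ccontr)
  let ?m = "csqrt (\<i> * of_real r)"
  assume "\<not> (?m = 0 \<or> sinh ?m \<noteq> 0)"
  then have "?m \<noteq> 0" "sinh ?m = 0" by auto
  then have "sin (\<i> * ?m) = 0" by (simp add: sinh_conv_sin)
  then obtain k :: int where "\<i> * ?m = of_real (of_int k * pi)"
    by (auto simp: sin_eq_0)
  then have "(\<i> * ?m)\<^sup>2 = of_real ((of_int k * pi)\<^sup>2)" by simp
  then have "- (\<i> * of_real r) = of_real ((of_int k * pi)\<^sup>2)" by (simp add: power_mult_distrib)
  then have "r = 0" by (auto dest!: arg_cong[where f = Im])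
  then show False using \<open>?m \<noteq> 0\<close> by simp
qed

context
  fixes h h' h'' :: "real \<Rightarrow> real" and B :: real
  assumes h: "\<And>x. x \<in> {0..1} \<Longrightarrow> (h has_real_derivative h' x) (at x within {0..1})"
    and h': "\<And>x. x \<in> {0..1} \<Longrightarrow> (h' has_real_derivative h'' x) (at x within {0..1})"
    and h0: "h 0 = 0" "h 1 = 0"
    and c: "continuous_on {0..1} h''"
    and B: "\<And>x. x \<in> {0..1} \<Longrightarrow> \<bar>h'' x\<bar> \<le> B"
begin

text \<open>
  Integrating the sine series of \<open>h\<close> against the kernel. In this form the dependence on \<open>r\<close> is plainly
  continuous, also at \<open>r = 0\<close>, where the kernel has a formula of its own.
\<close>

lemma green_transform_series:
  assumes x: "x \<in> {0..1}"
  shows "(\<lambda>n. of_real (sine_coeff h n * sin (freq n * x)) / (\<i> * of_real r + of_real ((freq n)\<^sup>2))) sums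
    integral {0..1} (\<lambda>y. green (csqrt (\<i> * of_real r)) x y * of_real (h y))"
proof -
  let ?m = "csqrt (\<i> * of_real r)"
  note m = sinh_csqrt_nonzero[of r]
  have cg: "continuous_on {0..1} (green ?m x)" by (rule continuous_on_green[OF x m])
  obtain K where K: "\<And>y. y \<in> {0..1} \<Longrightarrow> norm (green ?m x y) \<le> K" and "K > 0"
    using compact_imp_bounded[OF compact_continuous_image[OF cg compact_Icc]]
    unfolding bounded_pos by (metis imageI)
  let ?f = "\<lambda>n y. green ?m x y * of_real (sine_coeff h n * sin (freq n * y))"
  have "(\<lambda>n. integral {0..1} (?f n)) sums integral {0..1} (\<lambda>y. \<Sum>n. ?f n y)"
  proof (rule integral_series_of_continuous)
    show "continuous_on {0..1} (?f n)" for n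
      by (intro continuous_intros cg)
    show "summable (\<lambda>n. K * (2 * B / (freq n)\<^sup>2))"
      using summable_mult[OF summable_inverse_freq_sq, of "K * (2 * B)"] by simp
    fix n and y :: real assume y: "y \<in> {0..1}"
    have "\<bar>sine_coeff h n * sin (freq n * y)\<bar> \<le> 2 * B / (freq n)\<^sup>2 * 1"
      unfolding abs_mult using sine_coeff_bound[OF h h' h0 c B, of n] 
      by (intro mult_mono) auto
    then show "norm (?f n y) \<le> K * (2 * B / (freq n)\<^sup>2)"
      unfolding norm_mult norm_of_real using K[OF y] \<open>K > 0\<close> by (intro mult_mono) auto
  qed
  moreover have "integral {0..1} (?f n) =
      of_real (sine_coeff h n * sin (freq n * x)) / (\<i> * of_real r + of_real ((freq n)\<^sup>2))" for n
  proof -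
    have "?m\<^sup>2 + of_real ((freq n)\<^sup>2) \<noteq> 0"
      using ir_plus_nonzero[of "(freq n)\<^sup>2" r] freq_pos[of n] by simp
    have "?f n = (\<lambda>y. of_real (sine_coeff h n) * (green ?m x y * of_real (sin (freq n * y))))"
      by (simp add: fun_eq_iff mult_ac)
    then have "integral {0..1} (?f n) = of_real (sine_coeff h n) * integral {0..1} (\<lambda>y. green ?m x y * of_real (sin (freq n * y)))"
      by (simp only: integral_mult_right)
    also have "\<dots> = of_real (sine_coeff h n) * (of_real (sin (freq n * x)) / (?m\<^sup>2 + of_real ((freq n)\<^sup>2)))"
      by (simp only: green_sine[OF x m \<open>?m\<^sup>2 + of_real ((freq n)\<^sup>2) \<noteq> 0\<close>])
    finally show ?thesis by simp
  qed
  moreover have "integral {0..1} (\<lambda>y. \<Sum>n. ?f n y) = integral {0..1} (\<lambda>y. green ?m x y * of_real (h y))"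
  proof (rule integral_cong)
    fix y :: real assume y: "y \<in> {0..1}"
    have "?f n y = green ?m x y * of_real (sine_coeff h n * sin (freq n * y))" for n ..
    moreover have "(\<lambda>n. green ?m x y * of_real (sine_coeff h n * sin (freq n * y))) sums (green ?m x y * of_real (h y))"
      by (intro sums_mult sums_of_real sine_series[OF h h' h0 c B y])
    ultimately show "(\<Sum>n. ?f n y) = green ?m x y * of_real (h y)"
      by (simp add: sums_iff)
  qed
  ultimately show ?thesis by simp
qed

text \<open>
  Each term of the series contributes a truncated integral \<open>bromwich\<close>. Since these are bounded by
  \<open>(2 + \<pi>) / \<tau>\<close> for all modes and all \<open>M\<close>, and the coefficients are summable, Tannery's theorem
  exchanges the limit with the sum.
\<close>

lemma green_transform_pv:
  assumes x: "x \<in> {0..1}" and \<tau>: "\<tau> > 0"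
  shows "has_pv_integral
    (\<lambda>r. exp (\<i> * of_real r * of_real \<tau>) * integral {0..1} (\<lambda>y. green (csqrt (\<i> * of_real r)) x y * of_real (h y)))
    (of_real (2 * pi * (\<Sum>n. sine_coeff h n * sin (freq n * x) * exp (- (freq n)\<^sup>2 * \<tau>))))"
proof -
  let ?c = "\<lambda>n. sine_coeff h n * sin (freq n * x)"
  let ?b = "\<lambda>n. 2 * B / (freq n)\<^sup>2"
  have cb: "\<bar>?c n\<bar> \<le> ?b n" for n
  proof -
    have "\<bar>?c n\<bar> \<le> 2 * B / (freq n)\<^sup>2 * 1"
      unfolding abs_mult using sine_coeff_bound[OF h h' h0 c B, of n]
      by (intro mult_mono) auto
    then show ?thesis by simp
  qed
  have sb: "summable (\<lambda>n. k * ?b n)" for k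
    using summable_mult[OF summable_inverse_freq_sq, of "k * (2 * B)"] by simp
  have lam: "(freq n)\<^sup>2 \<ge> 1" for n using freq_ge_1[of n] by simp
  let ?f = "\<lambda>r. exp (\<i> * of_real r * of_real \<tau>) * integral {0..1} (\<lambda>y. green (csqrt (\<i> * of_real r)) x y * of_real (h y))"
  define g where "g n r = of_real (?c n) * (exp (\<i> * of_real r * of_real \<tau>) / (\<i> * of_real r + of_real ((freq n)\<^sup>2)))" for n r
  have f_eq: "?f r = (\<Sum>n. g n r)" for r
  proof -
    have "(\<lambda>n. exp (\<i> * of_real r * of_real \<tau>) * (of_real (?c n) / (\<i> * of_real r + of_real ((freq n)\<^sup>2)))) sums ?f r"
      by (intro sums_mult green_transform_series x)
    moreover have "exp (\<i> * of_real r * of_real \<tau>) * (of_real (?c n) / (\<i> * of_real r + of_real ((freq n)\<^sup>2))) = g n r" for n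
      by (simp add: g_def)
    ultimately show ?thesis by (simp add: sums_iff)
  qed
  have gc: "continuous_on S (g n)" for n S
    unfolding g_def using ir_plus_nonzero[of "(freq n)\<^sup>2"] freq_pos[of n]
    by (intro continuous_intros) auto
  have gb: "norm (g n r) \<le> ?b n" for n r
  proof -
    have "1 \<le> norm (\<i> * of_real r + of_real ((freq n)\<^sup>2))"
      using complex_Re_le_cmod[of "\<i> * of_real r + of_real ((freq n)\<^sup>2)"] lam[of n] by simp
    then have "norm (exp (\<i> * of_real r * of_real \<tau>) / (\<i> * of_real r + of_real ((freq n)\<^sup>2))) \<le> 1"
      by (simp add: norm_divide divide_simps)
    then have "norm (g n r) \<le> ?b n * 1"
      unfolding g_def norm_mult norm_of_real using cb[of n] by (intro mult_mono) auto
    then show ?thesis by simp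
  qed
  have sb1: "summable ?b" using sb[of 1] by simp
  have fc: "continuous_on S ?f" for S
    unfolding f_eq by (rule series_of_continuous(2)[OF gc gb sb1])
  have si: "set_integrable lborel {-M..M} ?f" for M
    by (rule borel_integrable_atLeastAtMost'[OF fc])
  have I: "(LBINT r:{-M..M}. ?f r) = (\<Sum>n. of_real (?c n) * bromwich \<tau> ((freq n)\<^sup>2) M)" for M
  proof -
    have gi: "integral {-M..M} (g n) = of_real (?c n) * bromwich \<tau> ((freq n)\<^sup>2) M" for n
      unfolding g_def bromwich_def by (rule integral_mult_right)
    have "(LBINT r:{-M..M}. ?f r) = integral {-M..M} ?f"
      by (rule set_borel_integral_eq_integral(2)[OF si])
    also have "\<dots> = (\<Sum>n. integral {-M..M} (g n))"
      unfolding f_eq by (rule sums_unique[OF integral_series_of_continuous[OF gc gb sb1]])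
    finally show ?thesis by (simp only: gi)
  qed
  have "((\<lambda>M. \<Sum>n. of_real (?c n) * bromwich \<tau> ((freq n)\<^sup>2) M) \<longlongrightarrow>
      (\<Sum>n. of_real (?c n) * of_real (2 * pi * exp (- (freq n)\<^sup>2 * \<tau>)))) at_top"
  proof (rule tannerys_theorem[THEN conjunct2, THEN conjunct2])
    show "((\<lambda>M. of_real (?c n) * bromwich \<tau> ((freq n)\<^sup>2) M) \<longlongrightarrow> of_real (?c n) * of_real (2 * pi * exp (- (freq n)\<^sup>2 * \<tau>))) at_top" for n
      using freq_pos[of n] by (intro tendsto_mult_left bromwich_limit \<tau>) auto
    show "\<forall>\<^sub>F (n, M) in sequentially \<times>\<^sub>F at_top. norm (of_real (?c n) * bromwich \<tau> ((freq n)\<^sup>2) M) \<le> (2 + pi) / \<tau> * ?b n"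
    proof -
      have "norm (of_real (?c n) * bromwich \<tau> ((freq n)\<^sup>2) M) \<le> (2 + pi) / \<tau> * ?b n" if "M \<ge> 0" for n M
        unfolding norm_mult norm_of_real mult.commute[of "\<bar>_\<bar>"]
        using bromwich_bound[OF \<tau> lam that] cb[of n] \<tau> pi_gt_zero
        by (intro mult_mono) auto
      then show ?thesis
        by (auto simp: eventually_prod_filter intro!: exI[of _ "\<lambda>_. True"] exI[of _ "\<lambda>M. M \<ge> 0"] eventually_ge_at_top)
    qed
    show "summable (\<lambda>n. (2 + pi) / \<tau> * ?b n)" by (rule sb)
  qed simp
  moreover have "(\<Sum>n. of_real (?c n) * of_real (2 * pi * exp (- (freq n)\<^sup>2 * \<tau>))) =
     complex_of_real (2 * pi * (\<Sum>n. ?c n * exp (- (freq n)\<^sup>2 * \<tau>)))"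
  proof -
    have "summable (\<lambda>n. ?c n * exp (- (freq n)\<^sup>2 * \<tau>))"
    proof (rule summable_comparison_test[OF _ sb1], intro exI allI impI)
      fix n
      have "\<bar>?c n\<bar> * exp (- (freq n)\<^sup>2 * \<tau>) \<le> ?b n * 1"
        using cb[of n] \<tau> by (intro mult_mono) auto
      then show "norm (?c n * exp (- (freq n)\<^sup>2 * \<tau>)) \<le> ?b n" by (simp add: abs_mult)
    qed
    then have "(\<lambda>n. complex_of_real (2 * pi * (?c n * exp (- (freq n)\<^sup>2 * \<tau>)))) sums
       of_real (2 * pi * (\<Sum>n. ?c n * exp (- (freq n)\<^sup>2 * \<tau>)))"
      by (intro sums_of_real sums_mult summable_sums)
    moreover have "complex_of_real (2 * pi * (?c n * exp (- (freq n)\<^sup>2 * \<tau>))) = of_real (?c n) * of_real (2 * pi * exp (- (freq n)\<^sup>2 * \<tau>))" for n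
      by (simp add: mult_ac)
    ultimately have "(\<lambda>n. of_real (?c n) * of_real (2 * pi * exp (- (freq n)\<^sup>2 * \<tau>))) sums
       complex_of_real (2 * pi * (\<Sum>n. ?c n * exp (- (freq n)\<^sup>2 * \<tau>)))"
      by (simp only:)
    then show ?thesis by (rule sums_unique[symmetric])
  qed
  ultimately show ?thesis
    unfolding has_pv_integral_def I using si by simp
qed

end

section \<open>Duhamel integrals and uniqueness\<close>

text \<open>The solution of \<open>w' = f - lam w\<close> that vanishes at time 0.\<close>

definition duhamel :: "real \<Rightarrow> (real \<Rightarrow> real) \<Rightarrow> real \<Rightarrow> real" where
  "duhamel lam f t = integral {0..t} (\<lambda>s. f s * exp (- lam * (t - s)))"

lemma duhamel_has_derivative:
  assumes f: "continuous_on {0..} f" and t: "t \<ge> 0"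
  shows "(duhamel lam f has_real_derivative f t - lam * duhamel lam f t) (at t within {0..})"
proof -
  let ?P = "\<lambda>t. integral {0..t} (\<lambda>s. f s * exp (lam * s))"
  have eq: "duhamel lam f = (\<lambda>t. exp (- lam * t) * ?P t)"
  proof
    fix t
    have "f s * exp (- lam * (t - s)) = exp (- lam * t) * (f s * exp (lam * s))" for s
      by (simp add: algebra_simps flip: exp_add)
    then show "duhamel lam f t = exp (- lam * t) * ?P t"
      by (simp only: duhamel_def integral_mult_right)
  qed
  have "(?P has_real_derivative f t * exp (lam * t)) (at t within {0..t+1})"
    using t by (intro integral_has_real_derivative continuous_intros continuous_on_subset[OF f]) auto
  moreover have "at t within {0..t+1} = at t within {0..}"
    by (rule at_within_nhd[of t "{..<t+1}"]) (use t in auto)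
  ultimately have P: "(?P has_real_derivative f t * exp (lam * t)) (at t within {0..})" by simp
  have "((\<lambda>t. exp (- lam * t) * ?P t) has_real_derivative
      exp (- lam * t) * (f t * exp (lam * t)) + (- lam * exp (- lam * t)) * ?P t) (at t within {0..})"
    by (rule derivative_eq_intros P refl)+ (simp add: algebra_simps)
  also have "exp (- lam * t) * (f t * exp (lam * t)) + (- lam * exp (- lam * t)) * ?P t =
      f t - lam * (exp (- lam * t) * ?P t)"
    by (simp add: exp_minus)
  finally show ?thesis unfolding eq .
qed

lemma continuous_on_duhamel:
  assumes "continuous_on {0..} f"
  shows "continuous_on {0..} (duhamel lam f)"
  by (rule DERIV_continuous_on[OF duhamel_has_derivative[OF assms]]) auto

lemma duhamel_bound:
  assumes f: "continuous_on {0..} f" and t: "t \<ge> 0" and lam: "lam > 0"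
    and C: "\<And>s. s \<ge> 0 \<Longrightarrow> \<bar>f s\<bar> \<le> C"
  shows "\<bar>duhamel lam f t\<bar> \<le> C / lam"
proof -
  have C0: "C \<ge> 0" using C[of 0] by simp
  have I: "((\<lambda>s. C * exp (- lam * (t - s))) has_integral
      C * exp (- lam * (t - t)) / lam - C * exp (- lam * (t - 0)) / lam) {0..t}"
    using lam t by (intro fundamental_theorem_of_calculus)
      (auto simp: has_real_derivative_iff_has_vector_derivative[symmetric] intro!: derivative_eq_intros)
  have "norm (duhamel lam f t) \<le> integral {0..t} (\<lambda>s. C * exp (- lam * (t - s)))"
    unfolding duhamel_def
  proof (rule integral_norm_bound_integral[OF _ has_integral_integrable[OF I]])
    show "(\<lambda>s. f s * exp (- lam * (t - s))) integrable_on {0..t}"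
      by (intro integrable_continuous_interval continuous_intros continuous_on_subset[OF f]) auto
    show "norm (f s * exp (- lam * (t - s))) \<le> C * exp (- lam * (t - s))" if "s \<in> {0..t}" for s
      using C[of s] that by (simp add: abs_mult)
  qed
  also have "\<dots> = C / lam - C * exp (- lam * t) / lam"
    by (simp only: integral_unique[OF I]) simp
  also have "\<dots> \<le> C / lam" using C0 lam by simp
  finally show ?thesis by simp
qed

lemma series_has_derivative:
  fixes f f' :: "nat \<Rightarrow> real \<Rightarrow> real"
  assumes "convex S" and d: "\<And>n x. x \<in> S \<Longrightarrow> (f n has_real_derivative f' n x) (at x within S)"
    and b: "\<And>n x. x \<in> S \<Longrightarrow> norm (f' n x) \<le> B n" and "summable B"
    and s: "\<And>x. x \<in> S \<Longrightarrow> summable (\<lambda>n. f n x)" and x: "x \<in> S"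
  shows "((\<lambda>x. \<Sum>n. f n x) has_real_derivative (\<Sum>n. f' n x)) (at x within S)"
proof -
  have "\<exists>g. \<forall>x\<in>S. (\<lambda>n. f n x) sums g x \<and> (g has_real_derivative (\<Sum>n. f' n x)) (at x within S)"
    by (rule has_field_derivative_series[OF \<open>convex S\<close> d Weierstrass_m_test[OF b \<open>summable B\<close>] x s[OF x]])
  then obtain g where g: "\<And>x. x \<in> S \<Longrightarrow> (\<lambda>n. f n x) sums g x"
      "\<And>x. x \<in> S \<Longrightarrow> (g has_real_derivative (\<Sum>n. f' n x)) (at x within S)"
    by blast
  show ?thesis
    unfolding has_field_derivative_def
    by (rule has_derivative_transform[OF x _ g(2)[OF x, unfolded has_field_derivative_def]])
      (use g(1) in \<open>simp add: sums_iff\<close>)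
qed

lemma heat_solutionE:
  assumes "heat_solution F u"
  obtains ut ux uxx where "has_dt u ut" "has_dx u ux" "has_dx ux uxx"
    "cont_strip u" "cont_strip ut" "cont_strip uxx"
    "\<And>x t. x \<in> {0<..<1} \<Longrightarrow> t > 0 \<Longrightarrow> ut x t - uxx x t = F x t"
    "\<And>t. t > 0 \<Longrightarrow> u 0 t = 0" "\<And>t. t > 0 \<Longrightarrow> u 1 t = 0" "\<And>x. x \<in> {0..1} \<Longrightarrow> u x 0 = 0"
proof -
  from assms obtain ut ux uxx where
    "has_dt u ut \<and> has_dx u ux \<and> has_dx ux uxx \<and>
     cont_strip u \<and> cont_strip ut \<and> cont_strip uxx \<and>
     (\<forall>x\<in>{0<..<1}. \<forall>t>0. ut x t - uxx x t = F x t) \<and>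
     (\<forall>t>0. u 0 t = 0 \<and> u 1 t = 0) \<and> (\<forall>x\<in>{0..1}. u x 0 = 0)"
    unfolding heat_solution_def by (elim exE)
  then show thesis by (intro that[of ut ux uxx]) simp_all
qed

lemma heat_solution_diff:
  assumes "heat_solution F u" "heat_solution F v"
  shows "heat_solution (\<lambda>x t. 0) (\<lambda>x t. u x t - v x t)"
proof -
  obtain ut ux uxx where u: "has_dt u ut" "has_dx u ux" "has_dx ux uxx"
    "cont_strip u" "cont_strip ut" "cont_strip uxx"
    "\<And>x t. x \<in> {0<..<1} \<Longrightarrow> t > 0 \<Longrightarrow> ut x t - uxx x t = F x t"
    "\<And>t. t > 0 \<Longrightarrow> u 0 t = 0" "\<And>t. t > 0 \<Longrightarrow> u 1 t = 0" "\<And>x. x \<in> {0..1} \<Longrightarrow> u x 0 = 0"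
    by (rule heat_solutionE[OF assms(1)]) (rule that)
  obtain vt vx vxx where v: "has_dt v vt" "has_dx v vx" "has_dx vx vxx"
    "cont_strip v" "cont_strip vt" "cont_strip vxx"
    "\<And>x t. x \<in> {0<..<1} \<Longrightarrow> t > 0 \<Longrightarrow> vt x t - vxx x t = F x t"
    "\<And>t. t > 0 \<Longrightarrow> v 0 t = 0" "\<And>t. t > 0 \<Longrightarrow> v 1 t = 0" "\<And>x. x \<in> {0..1} \<Longrightarrow> v x 0 = 0"
    by (rule heat_solutionE[OF assms(2)]) (rule that)
  have eq: "(ut x t - vt x t) - (uxx x t - vxx x t) = 0" if "x \<in> {0<..<1}" "t > 0" for x t
    using u(7)[OF that] v(7)[OF that] by simp
  have c: "cont_strip (\<lambda>x t. p x t - q x t)" if "cont_strip p" "cont_strip q" for p q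
    using continuous_on_diff[OF that[unfolded cont_strip_def]] by (simp add: cont_strip_def split_beta)
  show ?thesis
    unfolding heat_solution_def
  proof (rule exI[of _ "\<lambda>x t. ut x t - vt x t"], rule exI[of _ "\<lambda>x t. ux x t - vx x t"],
      rule exI[of _ "\<lambda>x t. uxx x t - vxx x t"], intro conjI)
    show "has_dt (\<lambda>x t. u x t - v x t) (\<lambda>x t. ut x t - vt x t)"
      using u(1) v(1) unfolding has_dt_def by (intro ballI allI impI DERIV_diff) simp_all
    show "has_dx (\<lambda>x t. u x t - v x t) (\<lambda>x t. ux x t - vx x t)"
      using u(2) v(2) unfolding has_dx_def by (intro ballI allI impI DERIV_diff) simp_all
    show "has_dx (\<lambda>x t. ux x t - vx x t) (\<lambda>x t. uxx x t - vxx x t)"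
      using u(3) v(3) unfolding has_dx_def by (intro ballI allI impI DERIV_diff) simp_all
  qed (use u(4-6,8-10) v(4-6,8-10) eq in \<open>auto intro: c\<close>)
qed

text \<open>
  Differentiating under the integral sign and integrating by parts, each sine coefficient \<open>Z\<close> of \<open>u\<close>
  satisfies \<open>Z' = - a\<^sup>2 Z\<close> for positive times, so \<open>exp (a\<^sup>2 s) Z s\<close> keeps its initial value zero.
\<close>

lemma heat_solution_zero:
  assumes "heat_solution (\<lambda>x t. 0) u" and x: "x \<in> {0..1}" and t: "t \<ge> 0"
  shows "u x t = 0"
proof -
  obtain ut ux uxx where dt: "has_dt u ut" and dx: "has_dx u ux" "has_dx ux uxx"
    and c: "cont_strip u" "cont_strip ut" "cont_strip uxx"
    and pde: "\<And>x t. x \<in> {0<..<1} \<Longrightarrow> t > 0 \<Longrightarrow> ut x t - uxx x t = 0"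
    and bd: "\<And>t. t > 0 \<Longrightarrow> u 0 t = 0" "\<And>t. t > 0 \<Longrightarrow> u 1 t = 0"
    and ic: "\<And>x. x \<in> {0..1} \<Longrightarrow> u x 0 = 0"
    by (rule heat_solutionE[OF assms(1)]) (rule that)
  have csl: "continuous_on {0..1} (\<lambda>y. w y s)" if "cont_strip w" "s \<ge> 0" for w s
    using that by (auto simp: cont_strip_def
        intro!: continuous_on_compose2[of half_strip "\<lambda>(x, t). w x t" _ "\<lambda>y. (y, s)", simplified] continuous_intros)
  show ?thesis
  proof (cases "t = 0 \<or> x = 0 \<or> x = 1")
    case True
    then show ?thesis using ic[OF x] bd t x by (cases "t = 0") auto
  next
    case False
    then have t0: "t > 0" and xi: "x \<in> {0<..<1}" using t x by auto
    have "integral {0..1} (\<lambda>y. u y t * sin (freq n * y)) = 0" for n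
    proof -
      define Z where "Z s = integral {0..1} (\<lambda>y. u y s * sin (freq n * y))" for s
      let ?a = "(freq n)\<^sup>2"
      have dZ: "(Z has_real_derivative integral {0..1} (\<lambda>y. ut y s * sin (freq n * y))) (at s within {0..})"
        if "s \<ge> 0" for s
      proof -
        have "((\<lambda>s. integral (cbox 0 1) (\<lambda>y. u y s * sin (freq n * y))) has_real_derivative
            integral (cbox 0 1) (\<lambda>y. ut y s * sin (freq n * y))) (at s within {0..})"
        proof (rule leibniz_rule_field_derivative)
          show "((\<lambda>s. u y s * sin (freq n * y)) has_real_derivative ut y s * sin (freq n * y)) (at s within {0..})"
            if "s \<in> {0..}" "y \<in> cbox 0 1" for s y
            using dt that by (intro DERIV_cmult_right) (auto simp: has_dt_def)
          show "(\<lambda>y. u y s * sin (freq n * y)) integrable_on cbox 0 1" if "s \<in> {0..}" for s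
            using that by (auto intro!: integrable_continuous_interval continuous_intros csl[OF c(1)])
          have "continuous_on ({0..} \<times> {0..1}) (\<lambda>p. (\<lambda>(x, t). ut x t) (snd p, fst p))"
            using c(2) unfolding cont_strip_def
            by (rule continuous_on_compose2) (auto intro!: continuous_intros)
          then show "continuous_on ({0..} \<times> cbox 0 1) (\<lambda>(s, y). ut y s * sin (freq n * y))"
            by (auto simp: split_beta intro!: continuous_intros)
        qed (use that in auto)
        then show ?thesis by (simp add: Z_def[abs_def])
      qed
      have ode: "integral {0..1} (\<lambda>y. ut y s * sin (freq n * y)) = - ?a * Z s" if "s > 0" for s
      proof -
        \<comment> \<open>the equation says nothing at the two end points, which form a null set\<close>
        have "integral {0..1} (\<lambda>y. ut y s * sin (freq n * y)) = integral {0..1} (\<lambda>y. uxx y s * sin (freq n * y))"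
          by (rule integral_spike[of "{0, 1}"]) (use pde[OF _ that] in auto)
        also have "\<dots> = - ?a * Z s"
          unfolding Z_def using that dx
          by (intro sine_by_parts[where h' = "\<lambda>y. ux y s"] csl c bd) (auto simp: has_dx_def)
        finally show ?thesis .
      qed
      have "exp (?a * t) * Z t = exp (?a * 0) * Z 0"
      proof (rule DERIV_isconst_end[OF t0])
        have "continuous_on {0..} Z" using dZ by (intro DERIV_continuous_on) auto
        then have "continuous_on {0..t} Z" by (rule continuous_on_subset) auto
        then show "continuous_on {0..t} (\<lambda>s. exp (?a * s) * Z s)"
          by (intro continuous_intros)
        fix s assume s: "0 < s" "s < t"
        have "at s within {0..} = at s" by (rule at_within_interior) (use s in auto)
        then have "(Z has_real_derivative - ?a * Z s) (at s)"
          using dZ[of s] s ode[of s] by simp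
        then show "((\<lambda>s. exp (?a * s) * Z s) has_real_derivative 0) (at s)"
          by (auto intro!: derivative_eq_intros)
      qed
      also have "Z 0 = integral {0..1} (\<lambda>y::real. 0)"
        unfolding Z_def by (rule integral_cong) (simp add: ic)
      finally show ?thesis by (simp add: Z_def)
    qed
    then show ?thesis by (intro sine_complete[OF csl[OF c(1) t] _ xi])
  qed
qed

section \<open>Existence and the integral formula\<close>

locale heat_source =
  fixes F Fx Fxx :: "real \<Rightarrow> real \<Rightarrow> real" and B :: real
  assumes dx: "has_dx F Fx" "has_dx Fx Fxx"
    and F0: "t \<ge> 0 \<Longrightarrow> F 0 t = 0" and F1: "t \<ge> 0 \<Longrightarrow> F 1 t = 0"
    and cF: "cont_strip F" and cFxx: "cont_strip Fxx"
    and B: "x \<in> {0..1} \<Longrightarrow> t \<ge> 0 \<Longrightarrow> \<bar>Fxx x t\<bar> \<le> B"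
begin

definition coeff :: "nat \<Rightarrow> real \<Rightarrow> real" where
  "coeff n t = sine_coeff (\<lambda>y. F y t) n"

definition mode :: "nat \<Rightarrow> real \<Rightarrow> real" where
  "mode n = duhamel ((freq n)\<^sup>2) (coeff n)"

definition sol :: "real \<Rightarrow> real \<Rightarrow> real" where
  "sol x t = (\<Sum>n. mode n t * sin (freq n * x))"

lemma slice:
  assumes "t \<ge> 0"
  shows "x \<in> {0..1} \<Longrightarrow> ((\<lambda>y. F y t) has_real_derivative Fx x t) (at x within {0..1})"
    and "x \<in> {0..1} \<Longrightarrow> ((\<lambda>y. Fx y t) has_real_derivative Fxx x t) (at x within {0..1})"
    and "F 0 t = 0" "F 1 t = 0"
    and "continuous_on {0..1} (\<lambda>y. Fxx y t)"
    and "x \<in> {0..1} \<Longrightarrow> \<bar>Fxx x t\<bar> \<le> B"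
    and "continuous_on {0..1} (\<lambda>y. F y t)"
proof -
  have csl: "continuous_on {0..1} (\<lambda>y. w y t)" if "cont_strip w" for w
    using that assms by (auto simp: cont_strip_def
        intro!: continuous_on_compose2[of half_strip "\<lambda>(x, t). w x t" _ "\<lambda>y. (y, t)", simplified] continuous_intros)
  show "continuous_on {0..1} (\<lambda>y. Fxx y t)" "continuous_on {0..1} (\<lambda>y. F y t)"
    by (auto intro: csl cF cFxx)
qed (use assms dx F0 F1 B in \<open>auto simp: has_dx_def\<close>)

lemma B_nonneg: "B \<ge> 0"
  using B[of 0 0] by simp

lemma summable_bound: "summable (\<lambda>n. k * (2 * B / (freq n)\<^sup>2))"
  using summable_mult[OF summable_inverse_freq_sq, of "k * (2 * B)"] by simp

lemma coeff_bound: "t \<ge> 0 \<Longrightarrow> \<bar>coeff n t\<bar> \<le> 2 * B / (freq n)\<^sup>2"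
  unfolding coeff_def by (rule sine_coeff_bound[OF slice(1-6)])

lemma continuous_on_coeff: "continuous_on {0..} (coeff n)"
proof -
  have "continuous_on ({0..} \<times> {0..1}) (\<lambda>p. (\<lambda>(x, t). F x t) (snd p, fst p))"
    using cF unfolding cont_strip_def
    by (rule continuous_on_compose2) (auto intro!: continuous_intros)
  then have "continuous_on ({0..} \<times> cbox 0 1) (\<lambda>(s, y). F y s * sin (freq n * y))"
    by (auto simp: split_beta intro!: continuous_intros)
  then have "continuous_on {0..} (\<lambda>s. integral (cbox 0 1) (\<lambda>y. F y s * sin (freq n * y)))"
    by (rule integral_continuous_on_param)
  then show ?thesis
    by (auto simp: coeff_def[abs_def] sine_coeff_def intro!: continuous_intros)
qed

lemma mode_has_derivative:
  "t \<ge> 0 \<Longrightarrow> (mode n has_real_derivative coeff n t - (freq n)\<^sup>2 * mode n t) (at t within {0..})"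
  unfolding mode_def by (rule duhamel_has_derivative[OF continuous_on_coeff])

lemma continuous_on_mode: "continuous_on {0..} (mode n)"
  unfolding mode_def by (rule continuous_on_duhamel[OF continuous_on_coeff])

text \<open>This is the gain of two powers of the frequency from dissipation that makes the series of \<open>u\<^sub>x\<^sub>x\<close>
  converge up to the boundary.\<close>

lemma freq_sq_mode_bound: "t \<ge> 0 \<Longrightarrow> (freq n)\<^sup>2 * \<bar>mode n t\<bar> \<le> 2 * B / (freq n)\<^sup>2"
  using duhamel_bound[OF continuous_on_coeff _ _ coeff_bound, of t "(freq n)\<^sup>2" n] freq_pos[of n]
  by (simp add: mode_def field_simps)

lemma mode_bounds:
  assumes "t \<ge> 0"
  shows "\<bar>mode n t\<bar> \<le> 2 * B / (freq n)\<^sup>2" and "freq n * \<bar>mode n t\<bar> \<le> 2 * B / (freq n)\<^sup>2"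
proof -
  have "1 * \<bar>mode n t\<bar> \<le> freq n * \<bar>mode n t\<bar>" using freq_ge_1[of n] by (intro mult_right_mono) auto
  moreover have "freq n * \<bar>mode n t\<bar> \<le> (freq n)\<^sup>2 * \<bar>mode n t\<bar>"
    using freq_ge_1[of n] by (intro mult_right_mono self_le_power) auto
  ultimately show "\<bar>mode n t\<bar> \<le> 2 * B / (freq n)\<^sup>2" "freq n * \<bar>mode n t\<bar> \<le> 2 * B / (freq n)\<^sup>2"
    using freq_sq_mode_bound[OF assms, of n] by auto
qed

lemma cont_strip_series:
  assumes "\<And>n. continuous_on {0..} (a n)" and "\<And>n t. t \<ge> 0 \<Longrightarrow> \<bar>a n t\<bar> \<le> k * (2 * B / (freq n)\<^sup>2)"
  shows "cont_strip (\<lambda>x t. \<Sum>n. a n t * sin (freq n * x))"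
proof -
  have "continuous_on half_strip (\<lambda>p. \<Sum>n. a n (snd p) * sin (freq n * fst p))"
  proof (rule series_of_continuous(2)[OF _ _ summable_bound[of k]])
    show "continuous_on half_strip (\<lambda>p. a n (snd p) * sin (freq n * fst p))" for n
      by (intro continuous_intros continuous_on_compose2[OF assms(1)]) auto
    fix n and p :: "real \<times> real" assume "p \<in> half_strip"
    then have "\<bar>a n (snd p)\<bar> \<le> k * (2 * B / (freq n)\<^sup>2)" by (intro assms(2)) auto
    from mult_mono[OF this abs_sin_le_one] this
    show "norm (a n (snd p) * sin (freq n * fst p)) \<le> k * (2 * B / (freq n)\<^sup>2)"
      by (simp add: abs_mult)
  qed
  then show ?thesis by (simp add: cont_strip_def split_beta)
qed

lemma summable_sine:
  assumes "\<And>n. \<bar>a n\<bar> \<le> k * (2 * B / (freq n)\<^sup>2)"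
  shows "summable (\<lambda>n. a n * sin (freq n * x))"
proof (rule summable_comparison_test[OF _ summable_bound[of k]], intro exI allI impI)
  fix n
  show "norm (a n * sin (freq n * x)) \<le> k * (2 * B / (freq n)\<^sup>2)"
    using mult_mono[OF assms[of n] abs_sin_le_one[of "freq n * x"]] assms[of n] by (simp add: abs_mult)
qed

lemma mode_deriv_bound:
  assumes "t \<ge> 0"
  shows "\<bar>coeff n t - (freq n)\<^sup>2 * mode n t\<bar> \<le> 2 * (2 * B / (freq n)\<^sup>2)"
proof -
  have "\<bar>coeff n t - (freq n)\<^sup>2 * mode n t\<bar> \<le> \<bar>coeff n t\<bar> + \<bar>(freq n)\<^sup>2 * mode n t\<bar>"
    by (rule abs_triangle_ineq4)
  also have "\<dots> \<le> 2 * B / (freq n)\<^sup>2 + 2 * B / (freq n)\<^sup>2"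
    using coeff_bound[OF assms, of n] freq_sq_mode_bound[OF assms, of n]
    by (intro add_mono) (auto simp: abs_mult)
  finally show ?thesis by simp
qed

text \<open>
  In \<open>u\<^sub>t - u\<^sub>x\<^sub>x\<close> the terms with the modes cancel, and the sine series of \<open>F\<close> remains.
\<close>

lemma heat_solution_sol: "heat_solution F sol"
proof -
  define ut where "ut x t = (\<Sum>n. (coeff n t - (freq n)\<^sup>2 * mode n t) * sin (freq n * x))" for x t
  define ux where "ux x t = (\<Sum>n. mode n t * freq n * cos (freq n * x))" for x t
  define uxx where "uxx x t = (\<Sum>n. - (freq n)\<^sup>2 * mode n t * sin (freq n * x))" for x t
  have mb: "\<bar>mode n t\<bar> \<le> 1 * (2 * B / (freq n)\<^sup>2)" if "t \<ge> 0" for n t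
    using mode_bounds(1)[OF that] by simp
  have mb2: "\<bar>- (freq n)\<^sup>2 * mode n t\<bar> \<le> 1 * (2 * B / (freq n)\<^sup>2)" if "t \<ge> 0" for n t
    using freq_sq_mode_bound[OF that] by (simp add: abs_mult)
  have mcos: "norm (mode n t * freq n * cos (freq n * x)) \<le> 1 * (2 * B / (freq n)\<^sup>2)" if "t \<ge> 0" for n t x
  proof -
    have "norm (mode n t * freq n * cos (freq n * x)) = freq n * \<bar>mode n t\<bar> * \<bar>cos (freq n * x)\<bar>"
      using freq_pos[of n] by (simp add: abs_mult)
    also have "\<dots> \<le> freq n * \<bar>mode n t\<bar>"
      using freq_pos[of n] by (intro mult_left_le) auto
    finally show ?thesis using mode_bounds(2)[OF that, of n] by simp
  qed
  have "has_dt sol ut"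
    unfolding has_dt_def
  proof (intro ballI allI impI)
    fix x t :: real assume "x \<in> {0..1}" "t \<ge> 0"
    show "(sol x has_real_derivative ut x t) (at t within {0..})"
      unfolding ut_def sol_def[abs_def]
    proof (rule series_has_derivative[OF _ _ _ summable_bound[of 2]])
      show "norm ((coeff n t - (freq n)\<^sup>2 * mode n t) * sin (freq n * x)) \<le> 2 * (2 * B / (freq n)\<^sup>2)"
        if "t \<in> {0..}" for n t
        using mult_left_le[of "\<bar>sin (freq n * x)\<bar>" "\<bar>coeff n t - (freq n)\<^sup>2 * mode n t\<bar>"]
          mode_deriv_bound[of t n] that by (simp add: abs_mult)
      show "summable (\<lambda>n. mode n t * sin (freq n * x))" if "t \<in> {0..}" for t
        using that by (intro summable_sine[OF mb]) auto
    qed (use \<open>t \<ge> 0\<close> in \<open>auto intro!: DERIV_cmult_right mode_has_derivative\<close>)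
  qed
  moreover have "has_dx sol ux"
    unfolding has_dx_def
  proof (intro ballI allI impI)
    fix x t :: real assume x: "x \<in> {0..1}" and t: "t \<ge> 0"
    show "((\<lambda>x. sol x t) has_real_derivative ux x t) (at x within {0..1})"
      unfolding ux_def sol_def
    proof (rule series_has_derivative[OF _ _ _ summable_bound[of 1] _ x])
      show "((\<lambda>x. mode n t * sin (freq n * x)) has_real_derivative mode n t * freq n * cos (freq n * x)) (at x within {0..1})" for n x
        by (auto intro!: derivative_eq_intros)
      show "norm (mode n t * freq n * cos (freq n * x)) \<le> 1 * (2 * B / (freq n)\<^sup>2)" for n x
        by (rule mcos[OF t])
    qed (use summable_sine[OF mb[OF t]] in auto)
  qed
  moreover have "has_dx ux uxx"
    unfolding has_dx_def
  proof (intro ballI allI impI)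
    fix x t :: real assume x: "x \<in> {0..1}" and t: "t \<ge> 0"
    show "((\<lambda>x. ux x t) has_real_derivative uxx x t) (at x within {0..1})"
      unfolding ux_def uxx_def
    proof (rule series_has_derivative[OF _ _ _ summable_bound[of 1] _ x])
      show "((\<lambda>x. mode n t * freq n * cos (freq n * x)) has_real_derivative - (freq n)\<^sup>2 * mode n t * sin (freq n * x)) (at x within {0..1})" for n x
        by (auto intro!: derivative_eq_intros simp: power2_eq_square)
      show "norm (- (freq n)\<^sup>2 * mode n t * sin (freq n * x)) \<le> 1 * (2 * B / (freq n)\<^sup>2)" for n x
        using mult_left_le[of "\<bar>sin (freq n * x)\<bar>" "\<bar>- (freq n)\<^sup>2 * mode n t\<bar>"] mb2[OF t, of n]
        by (simp add: abs_mult)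
      show "summable (\<lambda>n. mode n t * freq n * cos (freq n * x))" for x
      proof (rule summable_comparison_test[OF _ summable_bound[of 1]], intro exI allI impI)
        show "norm (mode n t * freq n * cos (freq n * x)) \<le> 1 * (2 * B / (freq n)\<^sup>2)" for n
          by (rule mcos[OF t])
      qed
    qed auto
  qed
  moreover have "cont_strip sol"
    unfolding sol_def by (rule cont_strip_series[OF continuous_on_mode mb])
  moreover have "cont_strip ut"
    unfolding ut_def by (rule cont_strip_series[OF _ mode_deriv_bound])
      (intro continuous_intros continuous_on_coeff continuous_on_mode)
  moreover have "cont_strip uxx"
    unfolding uxx_def by (rule cont_strip_series[OF _ mb2]) (intro continuous_intros continuous_on_mode)
  moreover have "ut x t - uxx x t = F x t" if "x \<in> {0<..<1}" "t > 0" for x t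
  proof -
    have t: "t \<ge> 0" using that by simp
    have "ut x t - uxx x t = (\<Sum>n. (coeff n t - (freq n)\<^sup>2 * mode n t) * sin (freq n * x) -
        (- (freq n)\<^sup>2 * mode n t * sin (freq n * x)))"
      unfolding ut_def uxx_def
      by (rule suminf_diff[OF summable_sine[OF mode_deriv_bound[OF t]] summable_sine[OF mb2[OF t]]])
    also have "\<dots> = (\<Sum>n. coeff n t * sin (freq n * x))"
      by (simp add: algebra_simps)
    also have "\<dots> = F x t"
      unfolding coeff_def using that by (intro sums_unique[symmetric] sine_series[OF slice(1-6)[OF t]]) auto
    finally show ?thesis .
  qed
  moreover have "sol 0 t = 0" "sol 1 t = 0" for t by (auto simp: sol_def)
  moreover have "sol x 0 = 0" for x by (simp add: sol_def mode_def duhamel_def)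
  ultimately show ?thesis unfolding heat_solution_def by blast
qed

lemma bounded_sol: "bounded_strip sol"
proof -
  let ?b = "\<lambda>n. 1 * (2 * B / (freq n)\<^sup>2)"
  have "norm (sol x t) \<le> (\<Sum>n. ?b n)" if "t \<ge> 0" for x t
    unfolding sol_def
  proof (rule norm_suminf_le[OF _ summable_bound])
    show "norm (mode n t * sin (freq n * x)) \<le> ?b n" for n
      using mult_left_le[of "\<bar>sin (freq n * x)\<bar>" "\<bar>mode n t\<bar>"] mode_bounds(1)[OF that, of n]
      by (simp add: abs_mult)
  qed
  then show ?thesis unfolding bounded_strip_def bounded_iff by (auto intro!: exI[of _ "\<Sum>n. ?b n"])
qed

lemma inner_integral:
  assumes x: "x \<in> {0..1}" and s: "s \<ge> 0"
  shows "set_integrable lborel {0..1} (heat_integrand F x t s r)"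
    and "(LBINT y:{0..1}. heat_integrand F x t s r y) =
      exp (\<i> * of_real r * of_real (t - s)) * integral {0..1} (\<lambda>y. green (csqrt (\<i> * of_real r)) x y * of_real (F y s))"
proof -
  have eq: "heat_integrand F x t s r =
     (\<lambda>y. exp (\<i> * of_real r * of_real (t - s)) * (green (csqrt (\<i> * of_real r)) x y * of_real (F y s)))"
    by (simp add: heat_integrand_def fun_eq_iff mult.assoc)
  show si: "set_integrable lborel {0..1} (heat_integrand F x t s r)"
    unfolding eq by (intro borel_integrable_atLeastAtMost' continuous_intros
        continuous_on_green[OF x sinh_csqrt_nonzero] slice(7)[OF s])
  show "(LBINT y:{0..1}. heat_integrand F x t s r y) =
      exp (\<i> * of_real r * of_real (t - s)) * integral {0..1} (\<lambda>y. green (csqrt (\<i> * of_real r)) x y * of_real (F y s))"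
    unfolding set_borel_integral_eq_integral(2)[OF si] unfolding eq by (rule integral_mult_right)
qed

text \<open>For \<open>s < t\<close>, the value of the inner principal value integral. The formula extends it continuously to
  \<open>s = t\<close>.\<close>

definition pv_value :: "real \<Rightarrow> real \<Rightarrow> real \<Rightarrow> real" where
  "pv_value x t s = 2 * pi * (\<Sum>n. coeff n s * sin (freq n * x) * exp (- (freq n)\<^sup>2 * (t - s)))"

lemma inner_pv:
  assumes x: "x \<in> {0..1}" and s: "s \<in> {0..<t}"
  shows "has_pv_integral (\<lambda>r. LBINT y:{0..1}. heat_integrand F x t s r y) (of_real (pv_value x t s))"
proof -
  have s': "s \<ge> 0" "t - s > 0" using s by auto
  show ?thesis
    using green_transform_pv[OF slice(1-6)[OF s'(1)] x s'(2)]
    unfolding inner_integral(2)[OF x s'(1)] pv_value_def coeff_def .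
qed

lemma pv_integral_eq:
  assumes "x \<in> {0..1}" and "s \<in> {0..<t}"
  shows "pv_integral (\<lambda>r. LBINT y:{0..1}. heat_integrand F x t s r y) = of_real (pv_value x t s)"
  using inner_pv[OF assms] unfolding has_pv_integral_def pv_integral_def
  by (intro tendsto_Lim) auto

lemma
  assumes t: "t \<ge> 0"
  shows continuous_on_pv_value: "continuous_on {0..t} (pv_value x t)"
    and integral_pv_value: "integral {0..t} (pv_value x t) = 2 * pi * sol x t"
proof -
  let ?f = "\<lambda>n s. coeff n s * sin (freq n * x) * exp (- (freq n)\<^sup>2 * (t - s))"
  have c: "continuous_on {0..t} (?f n)" for n
  proof -
    have "continuous_on {0..t} (coeff n)"
      by (rule continuous_on_subset[OF continuous_on_coeff]) auto
    then show ?thesis by (intro continuous_intros)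
  qed
  have b: "norm (?f n s) \<le> 1 * (2 * B / (freq n)\<^sup>2)" if "s \<in> {0..t}" for n s
  proof -
    have "\<bar>coeff n s\<bar> * \<bar>sin (freq n * x)\<bar> * exp (- (freq n)\<^sup>2 * (t - s)) \<le> 2 * B / (freq n)\<^sup>2 * 1 * 1"
      using coeff_bound[of s n] that B_nonneg by (intro mult_mono) auto
    then show ?thesis by (simp add: abs_mult)
  qed
  show "continuous_on {0..t} (pv_value x t)"
    unfolding pv_value_def[abs_def]
    by (intro continuous_on_mult_left series_of_continuous(2)[OF c b summable_bound])
  have "(\<lambda>n. integral {0..t} (?f n)) sums integral {0..t} (\<lambda>s. \<Sum>n. ?f n s)"
    by (rule integral_series_of_continuous[OF c b summable_bound])
  moreover have "integral {0..t} (?f n) = mode n t * sin (freq n * x)" for n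
  proof -
    have "?f n = (\<lambda>s. coeff n s * exp (- (freq n)\<^sup>2 * (t - s)) * sin (freq n * x))"
      by (simp add: fun_eq_iff mult_ac)
    then show ?thesis by (simp only: mode_def duhamel_def integral_mult_left)
  qed
  ultimately have "integral {0..t} (\<lambda>s. \<Sum>n. ?f n s) = sol x t"
    by (simp only: sol_def sums_iff)
  then show "integral {0..t} (pv_value x t) = 2 * pi * sol x t"
    unfolding pv_value_def[abs_def] by (simp only: integral_mult_right)
qed

text \<open>The integrand agrees on \<open>[0, t)\<close> with \<open>pv_value\<close>, which is continuous on \<open>[0, t]\<close>; the end point is a null set.\<close>

lemma outer_integral:
  assumes x: "x \<in> {0..1}" and t: "t \<ge> 0"
  shows "set_integrable lborel {0..<t} (\<lambda>s. pv_integral (\<lambda>r. LBINT y:{0..1}. heat_integrand F x t s r y))"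
    and "(LBINT s:{0..<t}. pv_integral (\<lambda>r. LBINT y:{0..1}. heat_integrand F x t s r y)) = of_real (2 * pi * sol x t)"
proof -
  let ?g = "\<lambda>s. complex_of_real (pv_value x t s)"
  let ?p = "\<lambda>s. pv_integral (\<lambda>r. LBINT y:{0..1}. heat_integrand F x t s r y)"
  have "set_integrable lborel {0..t} ?g"
    by (intro borel_integrable_atLeastAtMost' continuous_intros continuous_on_pv_value t)
  then have "set_integrable lborel {0..<t} ?g"
    by (rule set_integrable_subset) auto
  moreover have "set_integrable lborel {0..<t} ?g \<longleftrightarrow> set_integrable lborel {0..<t} ?p"
    by (intro set_integrable_cong refl) (simp add: pv_integral_eq[OF x])
  ultimately show si: "set_integrable lborel {0..<t} ?p" by simp
  have "((\<lambda>s. pv_value x t s) has_integral 2 * pi * sol x t) {0..t}"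
    using integrable_integral[OF integrable_continuous_interval[OF continuous_on_pv_value[OF t]]]
    by (simp only: integral_pv_value[OF t])
  then have "(?g has_integral of_real (2 * pi * sol x t)) {0..t}"
    by (rule has_integral_of_real)
  then have "(?g has_integral of_real (2 * pi * sol x t)) {0..<t}"
    by (rule has_integral_spike_set_eq[THEN iffD1, rotated 2]) (auto intro: negligible_subset[of "{t}"])
  then have "(?p has_integral of_real (2 * pi * sol x t)) {0..<t}"
    by (rule has_integral_eq[rotated]) (simp add: pv_integral_eq[OF x])
  then show "(LBINT s:{0..<t}. ?p s) = of_real (2 * pi * sol x t)"
    unfolding set_borel_integral_eq_integral(2)[OF si] by (rule integral_unique)
qed

end

theorem theorem2p4:
  fixes F Fx Fxx :: "real \<Rightarrow> real \<Rightarrow> real"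
  assumes "has_dx F Fx" and "has_dx Fx Fxx"
    and "\<And>t. t \<ge> 0 \<Longrightarrow> F 0 t = 0" and "\<And>t. t \<ge> 0 \<Longrightarrow> F 1 t = 0"
    and "\<And>t. t \<ge> 0 \<Longrightarrow> Fxx 0 t = 0" and "\<And>t. t \<ge> 0 \<Longrightarrow> Fxx 1 t = 0"
    and "cont_strip F" and "cont_strip Fx" and "cont_strip Fxx"
    and "bounded_strip F" and "bounded_strip Fx" and "bounded_strip Fxx"
  shows "\<exists>u\<^sub>2. heat_solution F u\<^sub>2 \<and> bounded_strip u\<^sub>2 \<and>
    (\<forall>v. heat_solution F v \<and> bounded_strip v \<longrightarrow> (\<forall>x\<in>{0..1}. \<forall>t\<ge>0. v x t = u\<^sub>2 x t)) \<and>
    (\<forall>x\<in>{0..1}. \<forall>t\<ge>0.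
       (\<forall>s\<in>{0..<t}.
          (\<forall>r. set_integrable lborel {0..1} (heat_integrand F x t s r)) \<and>
          (\<exists>L. has_pv_integral (\<lambda>r. LBINT y:{0..1}. heat_integrand F x t s r y) L)) \<and>
       set_integrable lborel {0..<t}
         (\<lambda>s. pv_integral (\<lambda>r. LBINT y:{0..1}. heat_integrand F x t s r y)) \<and>
       complex_of_real (u\<^sub>2 x t) =
         1 / (2 * of_real pi) *
           (LBINT s:{0..<t}. pv_integral (\<lambda>r. LBINT y:{0..1}. heat_integrand F x t s r y)))"
proof -
  obtain B where B: "\<And>p. p \<in> half_strip \<Longrightarrow> norm (case p of (x, t) \<Rightarrow> Fxx x t) \<le> B"
    using assms(12) unfolding bounded_strip_def bounded_iff by blast
  interpret heat_source F Fx Fxx B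
    by unfold_locales (use assms(1-4,7,9) B[of "(x, t)" for x t] in auto)
  show ?thesis
  proof (rule exI[of _ sol], intro conjI ballI allI impI heat_solution_sol bounded_sol)
    fix v :: "real \<Rightarrow> real \<Rightarrow> real" and x t :: real
    assume "heat_solution F v \<and> bounded_strip v" "x \<in> {0..1}" "t \<ge> 0"
    then show "v x t = sol x t"
      using heat_solution_zero[OF heat_solution_diff[OF _ heat_solution_sol]] by fastforce
  next
    fix x t :: real assume x: "x \<in> {0..1}" and t: "t \<ge> 0"
    show "set_integrable lborel {0..<t} (\<lambda>s. pv_integral (\<lambda>r. LBINT y:{0..1}. heat_integrand F x t s r y))"
      by (rule outer_integral(1)[OF x t])
    show "complex_of_real (sol x t) = 1 / (2 * of_real pi) *
        (LBINT s:{0..<t}. pv_integral (\<lambda>r. LBINT y:{0..1}. heat_integrand F x t s r y))"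
      unfolding outer_integral(2)[OF x t] by simp
    fix s assume s: "s \<in> {0..<t}"
    show "\<exists>L. has_pv_integral (\<lambda>r. LBINT y:{0..1}. heat_integrand F x t s r y) L"
      using inner_pv[OF x s] by blast
    show "set_integrable lborel {0..1} (heat_integrand F x t s r)" for r
      using s by (intro inner_integral(1)[OF x]) auto
  qed
qed

end
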